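(* Let $(1\to N_n\to G_n\to Q_n\to 1)_{n\in\mathbb{N}}$ be a sequence of extensions of finite groups with uniformly finite generating sets. Suppose that (1) the coarse disjoint union $N=\bigsqcup_{n\in\mathbb{N}}N_n$, where each $N_n$ has the metric induced from the word metric of $G_n$, admits a coarse embedding at infinity into Hilbert space; (2) the coarse disjoint union $Q=\bigsqcup_{n\in\mathbb{N}}Q_n$, where each $Q_n$ has the quotient metric, has Property A at infinity. Then the coarse disjoint union $G=\bigsqcup_{n\in\mathbb{N}}G_n$ admits a coarse embedding at infinity into Hilbert space.
   Context: $\mathbb{R}_+=[0,\infty)$. Uniformly finite generating sets: there is a positive integer $M$ such that each $G_n$ has a generating subset $S_n$ with $|S_n|\le M$; $G_n$ carries the word metric of $S_n$, $N_n\subseteq G_n$ the restricted metric, and $Q_n=G_n/N_n$ the quotient metric. Coarse disjoint union: the coarse disjoint union of finite metric spaces $(X_n,d_n)_{n\in\mathbb{N}}$ is $X=\bigsqcup_nX_n$ equipped with a metric $d$ whose restriction to each $X_n$ is $d_n$ and such that $d(X_n,X_m)\to\infty$ as $n+m\to\infty$ with $n\ne m$. Coarse embedding at infinity: a metric space $(X,d)$ admits a coarse embedding at infinity into Hilbert space if there exist two non-decreasing functions $\rho_+,\rho_-:\mathbb{R}_+\to\mathbb{R}_+$ with $\lim_{t\to\infty}\rho_\pm(t)=\infty$ such that for each $R>0$ there exists a bounded subset $K_R\subseteq X$ such that for any bounded subset $C\subset X\setminus K_R$ with $\operatorname{diam}(C)\le R$ there exists a map $f_C:C\to H$ into a Hilbert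 space $H$ satisfying $\rho_-(d(x,y))\le\|f_C(x)-f_C(y)\|\le\rho_+(d(x,y))$ for all $x,y\in C$. Property A at infinity: a uniformly discrete metric space $X$ of bounded geometry has Property A at infinity if for all $R,\varepsilon>0$ there exists $S\ge0$ such that for any $L\ge0$ there exists a finite subset $K_L\subset X$ with the property that for every finite subset $C\subset X\setminus K_L$ of diameter at most $L$ there is a map $\xi:C\to\ell^2(C)$, $x\mapsto\xi_x$, with: $\|\xi_x\|=1$ for all $x\in C$; $|1-\langle\xi_x,\xi_y\rangle|\le\varepsilon$ for all $x,y\in C$ with $d(x,y)\le R$; $\operatorname{supp}(\xi_x)\subset B_C(x,S)$ for all $x\in C$, where $B_C(x,S)$ is the ball of radius $S$ about $x$ in $C$. (Thus $S$ depends on $R,\varepsilon$ but not on $L$ or $C$.) *)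

theory Defs
  imports
    "HOL-Analysis.Analysis"
    "HOL-Algebra.Coset"
    "HOL-Algebra.Generated_Groups"
begin

section \<open>Word metrics\<close>

definition word_length :: "('a, 'b) monoid_scheme \<Rightarrow> 'a set \<Rightarrow> 'a \<Rightarrow> nat" where
  "word_length G S g =
     (LEAST k. \<exists>ws. length ws = k \<and> set ws \<subseteq> S \<union> (\<lambda>s. inv\<^bsub>G\<^esub> s) ` S \<and>
                     foldr (\<lambda>x y. x \<otimes>\<^bsub>G\<^esub> y) ws \<one>\<^bsub>G\<^esub> = g)"

text \<open>The left-invariant word metric. A normal subgroup carries the restriction of this function.\<close>

definition word_dist :: "('a, 'b) monoid_scheme \<Rightarrow> 'a set \<Rightarrow> 'a \<Rightarrow> 'a \<Rightarrow> real" where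
  "word_dist G S x y = real (word_length G S (inv\<^bsub>G\<^esub> x \<otimes>\<^bsub>G\<^esub> y))"

text \<open>
  The distance between two sets. For the word metric of a finite group and two cosets of a normal
  subgroup this is the quotient metric. (The library's \<open>setdist\<close> is tied to the type class
  of metric spaces.)
\<close>

definition set_dist :: "('a \<Rightarrow> 'a \<Rightarrow> real) \<Rightarrow> 'a set \<Rightarrow> 'a set \<Rightarrow> real" where
  "set_dist d A B = (INF (a, b) \<in> A \<times> B. d a b)"

definition quotient_dist :: "('a, 'b) monoid_scheme \<Rightarrow> 'a set \<Rightarrow> 'a set \<Rightarrow> 'a set \<Rightarrow> real" where
  "quotient_dist G S = set_dist (word_dist G S)"


section \<open>Coarse disjoint unions\<close>

text \<open>
  \<open>d\<close> is one of the (many) metrics that make the disjoint union of the spaces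
  \<open>(X n, \<delta> n)\<close> a coarse disjoint union; the underlying set is \<open>Sigma UNIV X\<close>.
\<close>

definition coarse_disjoint_union ::
    "(nat \<Rightarrow> 'a set) \<Rightarrow> (nat \<Rightarrow> 'a \<Rightarrow> 'a \<Rightarrow> real) \<Rightarrow> (nat \<times> 'a \<Rightarrow> nat \<times> 'a \<Rightarrow> real) \<Rightarrow> bool" where
  "coarse_disjoint_union X \<delta> d \<longleftrightarrow>
     Metric_space (Sigma UNIV X) d \<and>
     (\<forall>n. \<forall>x\<in>X n. \<forall>y\<in>X n. d (n, x) (n, y) = \<delta> n x y) \<and>
     (\<forall>R. \<exists>k. \<forall>n m. n \<noteq> m \<and> k \<le> n + m \<longrightarrow> R \<le> set_dist d ({n} \<times> X n) ({m} \<times> X m))"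


section \<open>Coarse embeddings at infinity and Property A at infinity\<close>

context Metric_space
begin

text \<open>
  HOL cannot quantify over types inside a formula, so the Hilbert space is a type parameter,
  shared by all the sets \<open>C\<close>. Sharing it loses nothing: a family of Hilbert spaces embeds
  isometrically into its orthogonal direct sum.
\<close>

definition coarsely_embeds_at_infinity :: "'h::{real_inner, complete_space} itself \<Rightarrow> bool" where
  "coarsely_embeds_at_infinity (H :: 'h itself) \<longleftrightarrow>
     (\<exists>\<rho>\<^sub>1 \<rho>\<^sub>2 :: real \<Rightarrow> real.
        mono_on {0..} \<rho>\<^sub>1 \<and> mono_on {0..} \<rho>\<^sub>2 \<and>
        (\<forall>t\<ge>0. 0 \<le> \<rho>\<^sub>1 t) \<and> (\<forall>t\<ge>0. 0 \<le> \<rho>\<^sub>2 t) \<and>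
        filterlim \<rho>\<^sub>1 at_top at_top \<and> filterlim \<rho>\<^sub>2 at_top at_top \<and>
        (\<forall>R>0. \<exists>K\<subseteq>M. mbounded K \<and>
           (\<forall>C. C \<subseteq> M - K \<and> mbounded C \<and> (\<forall>x\<in>C. \<forall>y\<in>C. d x y \<le> R) \<longrightarrow>
              (\<exists>f :: 'a \<Rightarrow> 'h. \<forall>x\<in>C. \<forall>y\<in>C.
                 \<rho>\<^sub>1 (d x y) \<le> norm (f x - f y) \<and> norm (f x - f y) \<le> \<rho>\<^sub>2 (d x y)))))"

definition uniformly_discrete :: bool where
  "uniformly_discrete \<longleftrightarrow> (\<exists>\<delta>>0. \<forall>x\<in>M. \<forall>y\<in>M. x \<noteq> y \<longrightarrow> \<delta> \<le> d x y)"

definition bounded_geometry :: bool where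
  "bounded_geometry \<longleftrightarrow> (\<forall>r. \<exists>b. \<forall>x\<in>M. finite (mcball x r) \<and> card (mcball x r) \<le> b)"

text \<open>
  For finite \<open>C\<close>, the elements of \<open>\<ell>\<^sup>2(C)\<close> are the functions from \<open>C\<close>
  to the complex numbers, with norm \<open>L2_set\<close> of the absolute values; \<open>\<xi> x z\<close> is
  the value of \<open>\<xi>\<^sub>x\<close> at \<open>z\<close>. Real-valued \<open>\<xi>\<close> are a special case.
\<close>

definition property_A_at_infinity :: bool where
  "property_A_at_infinity \<longleftrightarrow>
     uniformly_discrete \<and> bounded_geometry \<and>
     (\<forall>R>0. \<forall>\<epsilon>>0. \<exists>S\<ge>0. \<forall>L\<ge>0. \<exists>K\<subseteq>M. finite K \<and>
        (\<forall>C. C \<subseteq> M - K \<and> finite C \<and> (\<forall>x\<in>C. \<forall>y\<in>C. d x y \<le> L) \<longrightarrow>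
           (\<exists>\<xi> :: 'a \<Rightarrow> 'a \<Rightarrow> complex.
              (\<forall>x\<in>C. L2_set (\<lambda>z. cmod (\<xi> x z)) C = 1) \<and>
              (\<forall>x\<in>C. \<forall>y\<in>C. d x y \<le> R \<longrightarrow> cmod (1 - (\<Sum>z\<in>C. \<xi> x z * cnj (\<xi> y z))) \<le> \<epsilon>) \<and>
              (\<forall>x\<in>C. {z \<in> C. \<xi> x z \<noteq> 0} \<subseteq> mcball x S))))"

end


section \<open>The Hilbert space of square-summable real sequences\<close>

typedef ell2 = "{f :: nat \<Rightarrow> real. summable (\<lambda>i. (f i)\<^sup>2)}"
  morphisms ell2_nth Abs_ell2
  by (rule exI[of _ "\<lambda>_. 0"]) simp

setup_lifting type_definition_ell2

lemma summable_ell2_mult: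
  fixes f g :: "nat \<Rightarrow> real"
  assumes "summable (\<lambda>i. (f i)\<^sup>2)" "summable (\<lambda>i. (g i)\<^sup>2)"
  shows "summable (\<lambda>i. f i * g i)"
proof (rule summable_comparison_test)
  show "\<exists>N. \<forall>n\<ge>N. norm (f n * g n) \<le> (f n)\<^sup>2 + (g n)\<^sup>2"
  proof (intro exI allI impI)
    fix n :: nat
    have "2 * (\<bar>f n\<bar> * \<bar>g n\<bar>) \<le> (f n)\<^sup>2 + (g n)\<^sup>2"
      using sum_squares_bound[of "\<bar>f n\<bar>" "\<bar>g n\<bar>"] by (simp add: mult.assoc)
    moreover have "0 \<le> \<bar>f n\<bar> * \<bar>g n\<bar>"
      by simp
    ultimately have "\<bar>f n\<bar> * \<bar>g n\<bar> \<le> (f n)\<^sup>2 + (g n)\<^sup>2"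
      by linarith
    then show "norm (f n * g n) \<le> (f n)\<^sup>2 + (g n)\<^sup>2"
      by (simp add: abs_mult)
  qed
  show "summable (\<lambda>i. (f i)\<^sup>2 + (g i)\<^sup>2)"
    using assms by (rule summable_add)
qed

lemma summable_ell2_add:
  fixes f g :: "nat \<Rightarrow> real"
  assumes "summable (\<lambda>i. (f i)\<^sup>2)" "summable (\<lambda>i. (g i)\<^sup>2)"
  shows "summable (\<lambda>i. (f i + g i)\<^sup>2)"
proof -
  have "summable (\<lambda>i. (f i)\<^sup>2 + (g i)\<^sup>2 + 2 * (f i * g i))"
    using assms by (intro summable_add summable_mult summable_ell2_mult)
  then show ?thesis
    by (simp add: power2_sum mult.assoc)
qed

instantiation ell2 :: real_vector
begin

lift_definition zero_ell2 :: ell2 is "\<lambda>_. 0" by simp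

lift_definition plus_ell2 :: "ell2 \<Rightarrow> ell2 \<Rightarrow> ell2" is "\<lambda>f g i. f i + g i"
  by (rule summable_ell2_add)

lift_definition uminus_ell2 :: "ell2 \<Rightarrow> ell2" is "\<lambda>f i. - f i" by simp

lift_definition minus_ell2 :: "ell2 \<Rightarrow> ell2 \<Rightarrow> ell2" is "\<lambda>f g i. f i - g i"
  subgoal for f g using summable_ell2_add[of f "\<lambda>i. - g i"] by simp
  done

lift_definition scaleR_ell2 :: "real \<Rightarrow> ell2 \<Rightarrow> ell2" is "\<lambda>r f i. r * f i"
  by (simp add: power_mult_distrib summable_mult)

instance
  by intro_classes (transfer; simp add: fun_eq_iff algebra_simps)+

end

instantiation ell2 :: real_inner
begin

lift_definition inner_ell2 :: "ell2 \<Rightarrow> ell2 \<Rightarrow> real" is "\<lambda>f g. \<Sum>i. f i * g i" .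

definition norm_ell2 :: "ell2 \<Rightarrow> real" where
  "norm_ell2 x = sqrt (inner x x)"

definition sgn_ell2 :: "ell2 \<Rightarrow> ell2" where
  "sgn_ell2 x = x /\<^sub>R norm x"

definition dist_ell2 :: "ell2 \<Rightarrow> ell2 \<Rightarrow> real" where
  "dist_ell2 x y = norm (x - y)"

definition uniformity_ell2 :: "(ell2 \<times> ell2) filter" where
  "uniformity_ell2 = (INF e\<in>{0 <..}. principal {(x, y). dist x y < e})"

definition open_ell2 :: "ell2 set \<Rightarrow> bool" where
  "open_ell2 S = (\<forall>x\<in>S. \<forall>\<^sub>F (x', y) in uniformity. x' = x \<longrightarrow> y \<in> S)"

instance
proof
  fix x y z :: ell2 and r :: real
  show "inner x y = inner y x"
    by transfer (simp add: mult.commute)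
  show "inner (x + y) z = inner x z + inner y z"
    by transfer (simp add: distrib_right suminf_add summable_ell2_mult)
  show "inner (scaleR r x) y = r * inner x y"
    by transfer (simp add: mult.assoc suminf_mult summable_ell2_mult)
  show "0 \<le> inner x x"
    by transfer (simp add: suminf_nonneg summable_ell2_mult)
  show "inner x x = 0 \<longleftrightarrow> x = 0"
    by transfer (simp add: suminf_eq_zero_iff summable_ell2_mult fun_eq_iff)
qed (rule sgn_ell2_def dist_ell2_def uniformity_ell2_def open_ell2_def norm_ell2_def)+

end

lemma ell2_norm_power2: "(norm x)\<^sup>2 = (\<Sum>i. (ell2_nth x i)\<^sup>2)"
proof -
  have "(norm x)\<^sup>2 = inner x x"
    by (rule power2_norm_eq_inner)
  then show ?thesis
    by (simp add: inner_ell2.rep_eq power2_eq_square)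
qed

lemma ell2_sum_le_norm: "(\<Sum>i<n. (ell2_nth x i)\<^sup>2) \<le> (norm x)\<^sup>2"
  unfolding ell2_norm_power2 using ell2_nth[of x] by (intro sum_le_suminf) auto

lemma ell2_nth_le_norm: "\<bar>ell2_nth x i\<bar> \<le> norm x"
proof -
  have "(ell2_nth x i)\<^sup>2 \<le> (\<Sum>j<Suc i. (ell2_nth x j)\<^sup>2)"
    by (simp add: sum_nonneg)
  also have "\<dots> \<le> (norm x)\<^sup>2"
    by (rule ell2_sum_le_norm)
  finally show ?thesis
    using abs_le_square_iff[of "ell2_nth x i" "norm x"] by simp
qed

instance ell2 :: complete_space
proof
  fix X :: "nat \<Rightarrow> ell2"
  assume "Cauchy X"
  have "Cauchy (\<lambda>n. ell2_nth (X n) i)" for i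
  proof (rule metric_CauchyI)
    fix e :: real assume "0 < e"
    then obtain N where N: "\<And>m n. m \<ge> N \<Longrightarrow> n \<ge> N \<Longrightarrow> dist (X m) (X n) < e"
      using metric_CauchyD[OF \<open>Cauchy X\<close>] by blast
    have "dist (ell2_nth (X m) i) (ell2_nth (X n) i) < e" if "m \<ge> N" "n \<ge> N" for m n
      using N[OF that] ell2_nth_le_norm[of "X m - X n" i]
      by (simp add: dist_norm minus_ell2.rep_eq)
    then show "\<exists>N. \<forall>m\<ge>N. \<forall>n\<ge>N. dist (ell2_nth (X m) i) (ell2_nth (X n) i) < e"
      by blast
  qed
  then have "\<forall>i. \<exists>l. (\<lambda>n. ell2_nth (X n) i) \<longlonglongrightarrow> l"
    by (auto simp: Cauchy_convergent_iff convergent_def)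
  then obtain g where g: "\<And>i. (\<lambda>n. ell2_nth (X n) i) \<longlonglongrightarrow> g i"
    by metis
  have bound: "(\<Sum>i<k. (ell2_nth (X n) i - g i)\<^sup>2) \<le> e\<^sup>2"
    if "0 < e" and N: "\<And>m n. m \<ge> N \<Longrightarrow> n \<ge> N \<Longrightarrow> dist (X m) (X n) < e" and "n \<ge> N" for e N n k
  proof (rule tendsto_upperbound)
    show "(\<lambda>m. \<Sum>i<k. (ell2_nth (X n) i - ell2_nth (X m) i)\<^sup>2)
            \<longlonglongrightarrow> (\<Sum>i<k. (ell2_nth (X n) i - g i)\<^sup>2)"
      by (intro tendsto_intros g)
    have "(\<Sum>i<k. (ell2_nth (X n) i - ell2_nth (X m) i)\<^sup>2) \<le> e\<^sup>2" if "m \<ge> N" for m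
    proof -
      have "(\<Sum>i<k. (ell2_nth (X n) i - ell2_nth (X m) i)\<^sup>2) \<le> (norm (X n - X m))\<^sup>2"
        using ell2_sum_le_norm[of "X n - X m" k] by (simp add: minus_ell2.rep_eq)
      also have "\<dots> \<le> e\<^sup>2"
        using N[OF \<open>n \<ge> N\<close> \<open>m \<ge> N\<close>] by (intro power_mono) (auto simp: dist_norm)
      finally show ?thesis .
    qed
    then show "\<forall>\<^sub>F m in sequentially. (\<Sum>i<k. (ell2_nth (X n) i - ell2_nth (X m) i)\<^sup>2) \<le> e\<^sup>2"
      by (auto simp: eventually_sequentially)
  qed simp
  have summable_diff: "summable (\<lambda>i. (ell2_nth (X n) i - g i)\<^sup>2)"
    if "0 < e" "\<And>m n. m \<ge> N \<Longrightarrow> n \<ge> N \<Longrightarrow> dist (X m) (X n) < e" "n \<ge> N" for e N n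
    by (rule summableI_nonneg_bounded[OF _ bound[OF that]]) auto
  obtain N where N: "\<And>m n. m \<ge> N \<Longrightarrow> n \<ge> N \<Longrightarrow> dist (X m) (X n) < 1"
    using metric_CauchyD[OF \<open>Cauchy X\<close>, of 1] by auto
  have "summable (\<lambda>i. (ell2_nth (X N) i - g i)\<^sup>2)"
    by (rule summable_diff[OF zero_less_one N order_refl])
  then have "summable (\<lambda>i. (- (ell2_nth (X N) i - g i))\<^sup>2)"
    by (simp only: power2_minus)
  moreover have "summable (\<lambda>i. (ell2_nth (X N) i)\<^sup>2)"
    using ell2_nth[of "X N"] by simp
  ultimately have "summable (\<lambda>i. (ell2_nth (X N) i + - (ell2_nth (X N) i - g i))\<^sup>2)"
    by (intro summable_ell2_add)
  then have g_sum: "summable (\<lambda>i. (g i)\<^sup>2)"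
    by simp
  define l where "l = Abs_ell2 g"
  have l: "ell2_nth l = g"
    unfolding l_def using g_sum by (simp add: Abs_ell2_inverse)
  have "X \<longlonglongrightarrow> l"
  proof (rule metric_LIMSEQ_I)
    fix r :: real assume "0 < r"
    then obtain N where N: "\<And>m n. m \<ge> N \<Longrightarrow> n \<ge> N \<Longrightarrow> dist (X m) (X n) < r / 2"
      using metric_CauchyD[OF \<open>Cauchy X\<close>, of "r / 2"] by auto
    have "dist (X n) l < r" if "n \<ge> N" for n
    proof -
      have "(norm (X n - l))\<^sup>2 \<le> (r / 2)\<^sup>2"
        unfolding ell2_norm_power2 minus_ell2.rep_eq l
      proof (rule suminf_le_const)
        show "summable (\<lambda>i. (ell2_nth (X n) i - g i)\<^sup>2)"
          by (rule summable_diff[OF half_gt_zero[OF \<open>0 < r\<close>] N that])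
        show "(\<Sum>i<k. (ell2_nth (X n) i - g i)\<^sup>2) \<le> (r / 2)\<^sup>2" for k
          by (rule bound[OF half_gt_zero[OF \<open>0 < r\<close>] N that])
      qed
      then have "norm (X n - l) \<le> r / 2"
        by (rule power2_le_imp_le) (rule less_imp_le[OF half_gt_zero[OF \<open>0 < r\<close>]])
      also have "\<dots> < r"
        using \<open>0 < r\<close> by linarith
      finally show ?thesis
        by (simp only: dist_norm)
    qed
    then show "\<exists>N. \<forall>n\<ge>N. dist (X n) l < r"
      by blast
  qed
  then show "convergent X"
    by (auto simp: convergent_def)
qed

end

theory Submission
  imports Defs "HOL-Real_Asymp.Real_Asymp"
begin

text \<open>
  For fixed \<open>R\<close> and \<open>\<epsilon>\<close>, Property A of the quotient provides unit vectors \<open>\<xi>\<close> whose supports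
  have a radius \<open>s\<close> independent of the diameter of \<open>C\<close>. Over a coset \<open>q\<close> in the support, points
  of \<open>C\<close> move by at most \<open>s\<close> into \<open>q\<close>, and a translate of \<open>q\<close> is the normal subgroup, which
  embeds by a map \<open>v\<^sub>q\<close>. The kernel
  \<open>\<Sum>\<^sub>q Re (\<xi>\<^sub>x(q) cnj \<xi>\<^sub>y(q)) exp (- t \<parallel>v\<^sub>q x - v\<^sub>q y\<parallel>\<^sup>2)\<close>
  is positive semidefinite, within \<open>\<epsilon>\<close> of 1 at distance up to \<open>R\<close>, and at most 1/2 at distance
  beyond some \<open>T\<close> not depending on the diameter. Summing such kernels over \<open>R = j + 1\<close>,
  \<open>\<epsilon> = 2\<^sup>-\<^sup>j\<close> gives the embedding. For sets of diameter at most \<open>L\<close> only the finitely many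
  \<open>j \<le> \<lceil>L\<rceil>\<close> are needed, so only finitely many exceptional sets have to be removed.
\<close>

section \<open>Positive semidefinite kernels\<close>

text \<open>Symmetry is demanded separately because a real quadratic form only sees the symmetric
  part of \<open>k\<close>. The notion is meant for finite \<open>C\<close>: sums over an infinite
  set are 0 by convention.\<close>

definition psd_kernel :: "'a set \<Rightarrow> ('a \<Rightarrow> 'a \<Rightarrow> real) \<Rightarrow> bool" where
  "psd_kernel C k \<longleftrightarrow> (\<forall>x\<in>C. \<forall>y\<in>C. k x y = k y x) \<and>
     (\<forall>c. 0 \<le> (\<Sum>x\<in>C. \<Sum>y\<in>C. c x * c y * k x y))"

lemma psd_kernel_rank_one: "psd_kernel C (\<lambda>x y. u x * u y)"
proof -
  have "(\<Sum>x\<in>C. \<Sum>y\<in>C. c x * c y * (u x * u y)) = (\<Sum>x\<in>C. c x * u x)\<^sup>2" for c :: "'a \<Rightarrow> real"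
    by (simp add: power2_eq_square sum_product mult_ac)
  then show ?thesis
    by (simp add: psd_kernel_def mult.commute)
qed

text \<open>A Gram matrix: the quadratic form at \<open>c\<close> is the squared norm of the
  combination of the vectors \<open>v x\<close> with coefficients \<open>c x\<close>.\<close>

lemma psd_kernel_inner:
  fixes v :: "'a \<Rightarrow> 'h::real_inner"
  shows "psd_kernel C (\<lambda>x y. inner (v x) (v y))"
proof -
  have "(\<Sum>x\<in>C. \<Sum>y\<in>C. c x * c y * inner (v x) (v y))
      = inner (\<Sum>x\<in>C. c x *\<^sub>R v x) (\<Sum>x\<in>C. c x *\<^sub>R v x)" for c :: "'a \<Rightarrow> real"
    by (simp add: inner_sum_left inner_sum_right mult.assoc sum_distrib_left)
       (simp add: inner_commute)
  then show ?thesis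
    by (simp add: psd_kernel_def inner_commute)
qed

lemma psd_kernel_add:
  "psd_kernel C k \<Longrightarrow> psd_kernel C l \<Longrightarrow> psd_kernel C (\<lambda>x y. k x y + l x y)"
  by (simp add: psd_kernel_def distrib_left sum.distrib)

lemma psd_kernel_zero: "psd_kernel C (\<lambda>x y. 0)"
  by (simp add: psd_kernel_def)

lemma psd_kernel_sum:
  "(\<And>i. i \<in> I \<Longrightarrow> psd_kernel C (k i)) \<Longrightarrow> psd_kernel C (\<lambda>x y. \<Sum>i\<in>I. k i x y)"
  by (induction I rule: infinite_finite_induct) (auto intro: psd_kernel_zero psd_kernel_add)

lemma psd_kernel_cmult:
  assumes "psd_kernel C k" "0 \<le> t"
  shows "psd_kernel C (\<lambda>x y. t * k x y)"
proof -
  have "(\<Sum>x\<in>C. \<Sum>y\<in>C. c x * c y * (t * k x y)) = t * (\<Sum>x\<in>C. \<Sum>y\<in>C. c x * c y * k x y)" for c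
    by (simp add: sum_distrib_left mult_ac)
  then show ?thesis
    using assms by (simp add: psd_kernel_def)
qed

text \<open>Congruence by a diagonal matrix: replacing \<open>c x\<close> by
  \<open>c x * u x\<close> turns the form of \<open>k\<close> into the form of the rescaled
  kernel.\<close>

lemma psd_kernel_rescale:
  assumes "psd_kernel C k"
  shows "psd_kernel C (\<lambda>x y. u x * u y * k x y)"
proof -
  have "(\<Sum>x\<in>C. \<Sum>y\<in>C. c x * c y * (u x * u y * k x y))
      = (\<Sum>x\<in>C. \<Sum>y\<in>C. (c x * u x) * (c y * u y) * k x y)" for c
    by (simp add: mult_ac)
  moreover have "0 \<le> (\<Sum>x\<in>C. \<Sum>y\<in>C. (c x * u x) * (c y * u y) * k x y)" for c
    using assms unfolding psd_kernel_def by (auto dest!: spec[of _ "\<lambda>x. c x * u x"])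
  ultimately show ?thesis
    using assms by (simp add: psd_kernel_def)
qed

section \<open>Limits, finite rank factorization and products of kernels\<close>

lemma psd_kernel_cong:
  "(\<And>x y. x \<in> C \<Longrightarrow> y \<in> C \<Longrightarrow> k x y = l x y) \<Longrightarrow> psd_kernel C k \<longleftrightarrow> psd_kernel C l"
  by (simp add: psd_kernel_def cong: sum.cong)

lemma psd_kernel_limit:
  assumes "\<And>m. psd_kernel C (k m)"
    and lim: "\<And>x y. x \<in> C \<Longrightarrow> y \<in> C \<Longrightarrow> (\<lambda>m. k m x y) \<longlonglongrightarrow> l x y"
  shows "psd_kernel C l"
  unfolding psd_kernel_def
proof (intro conjI ballI allI)
  fix x y assume "x \<in> C" "y \<in> C"
  then have "(\<lambda>m. k m y x) = (\<lambda>m. k m x y)"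
    using assms(1) by (auto simp: psd_kernel_def)
  then show "l x y = l y x"
    using lim[OF \<open>x \<in> C\<close> \<open>y \<in> C\<close>] lim[OF \<open>y \<in> C\<close> \<open>x \<in> C\<close>] LIMSEQ_unique by metis
next
  fix c
  have "(\<lambda>m. \<Sum>x\<in>C. \<Sum>y\<in>C. c x * c y * k m x y)
      \<longlonglongrightarrow> (\<Sum>x\<in>C. \<Sum>y\<in>C. c x * c y * l x y)"
    by (intro tendsto_intros lim)
  moreover have "0 \<le> (\<Sum>x\<in>C. \<Sum>y\<in>C. c x * c y * k m x y)" for m
    using assms(1) by (auto simp: psd_kernel_def)
  ultimately show "0 \<le> (\<Sum>x\<in>C. \<Sum>y\<in>C. c x * c y * l x y)"
    by (auto intro: LIMSEQ_le_const)
qed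

text \<open>Cholesky factorization by induction on \<open>C\<close>: splitting off \<open>a\<close>
  leaves the Schur complement, a kernel on the smaller set, and one further coordinate restores the
  row and column of \<open>a\<close>.\<close>

lemma psd_kernel_factor:
  assumes "finite C" "psd_kernel C k"
  shows "\<exists>(n::nat) u. \<forall>x\<in>C. \<forall>y\<in>C. k x y = (\<Sum>i<n. u i x * u i y)"
  using assms
proof (induction C arbitrary: k rule: finite_induct)
  case empty
  then show ?case by simp
next
  case (insert a C)
  have sym: "k x y = k y x" if "x \<in> insert a C" "y \<in> insert a C" for x y
    using insert.prems that unfolding psd_kernel_def by blast
  \<comment> \<open>The quadratic form on \<open>insert a C\<close> at the vector that is
    \<open>s\<close> at \<open>a\<close> and \<open>c\<close> on \<open>C\<close>. The facts below
    are special choices of \<open>s\<close> and \<open>c\<close>.\<close>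
  have expand: "0 \<le> s\<^sup>2 * k a a + 2 * s * (\<Sum>y\<in>C. c y * k a y) + (\<Sum>x\<in>C. \<Sum>y\<in>C. c x * c y * k x y)"
    for c s
  proof -
    define c' where "c' = c(a := s)"
    have c': "c' a = s" "\<And>x. x \<in> C \<Longrightarrow> c' x = c x"
      using insert.hyps by (auto simp: c'_def)
    have "0 \<le> (\<Sum>x\<in>insert a C. \<Sum>y\<in>insert a C. c' x * c' y * k x y)"
      using insert.prems by (simp add: psd_kernel_def)
    also have "\<dots> = s\<^sup>2 * k a a + s * (\<Sum>y\<in>C. c y * k a y) + s * (\<Sum>x\<in>C. c x * k x a)
        + (\<Sum>x\<in>C. \<Sum>y\<in>C. c x * c y * k x y)"
      using insert.hyps
      by (simp add: c' power2_eq_square sum_distrib_left sum.distrib algebra_simps cong: sum.cong)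
    also have "(\<Sum>x\<in>C. c x * k x a) = (\<Sum>y\<in>C. c y * k a y)"
      by (intro sum.cong refl) (simp add: sym)
    finally show ?thesis by (simp add: algebra_simps)
  qed
  have kaa: "0 \<le> k a a"
    using expand[of 1 "\<lambda>_. 0"] by simp
  \<comment> \<open>If \<open>k a a = 0\<close>, the form at \<open>s\<close> on \<open>a\<close>
    and 1 on \<open>x\<close> is affine in \<open>s\<close> with slope \<open>2 * k a x\<close>.
    Unless the slope is 0 it takes the value -1, at the \<open>s\<close> chosen at the end.\<close>
  have null: "k a x = 0" if "k a a = 0" "x \<in> C" for x
  proof (rule ccontr)
    assume nz: "k a x \<noteq> 0"
    have "0 \<le> 2 * s * k a x + k x x" for s
    proof -
      have d: "(\<Sum>y\<in>C. (if y = x then 1 else 0) * f y) = f x" for f :: "'a \<Rightarrow> real"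
        using that insert.hyps by (simp add: if_distrib[of "\<lambda>z. z * _"] cong: if_cong)
      show ?thesis
        using expand[of s "\<lambda>y. if y = x then 1 else 0"] that insert.hyps(1)
        by (simp add: d mult.assoc flip: sum_distrib_left)
    qed
    from this[of "- (k x x + 1) / (2 * k a x)"] show False
      using nz by (simp add: field_simps)
  qed
  \<comment> \<open>The Schur complement of \<open>k a a\<close>. By \<open>null\<close> it also behaves if \<open>k a a = 0\<close>, where division gives 0.\<close>
  define l where "l x y = k x y - k a x * k a y / k a a" for x y
  have l_a: "l a x = 0" "l x a = 0" if "x \<in> insert a C" for x
    using that null sym[of x a] by (auto simp: l_def)
  have "psd_kernel C l"
    unfolding psd_kernel_def
  proof (intro conjI ballI allI)
    fix x y assume "x \<in> C" "y \<in> C"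
    then show "l x y = l y x"
      using sym by (simp add: l_def)
  next
    fix c
    define p where "p = (\<Sum>y\<in>C. c y * k a y)"
    have "(\<Sum>x\<in>C. \<Sum>y\<in>C. c x * c y * l x y) = (\<Sum>x\<in>C. \<Sum>y\<in>C. c x * c y * k x y) - p\<^sup>2 / k a a"
      by (simp add: l_def p_def power2_eq_square sum_product sum_divide_distrib sum_subtractf
          right_diff_distrib mult_ac)
    \<comment> \<open>For \<open>k a a > 0\<close> the value \<open>- p / k a a\<close> minimises
      the form in \<open>s\<close>. For \<open>k a a = 0\<close> both sides are 0.\<close>
    moreover have "(- p / k a a)\<^sup>2 * k a a + 2 * (- p / k a a) * p = - p\<^sup>2 / k a a"
      by (cases "k a a = 0") (simp_all add: power2_eq_square field_simps)
    ultimately show "0 \<le> (\<Sum>x\<in>C. \<Sum>y\<in>C. c x * c y * l x y)"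
      using expand[of "- p / k a a" c] by (simp add: p_def)
  qed
  then obtain n :: nat and u where u: "\<forall>x\<in>C. \<forall>y\<in>C. l x y = (\<Sum>i<n. u i x * u i y)"
    using insert.IH by blast
  \<comment> \<open>The first \<open>n\<close> coordinates factor \<open>l\<close> and vanish at
    \<open>a\<close>, as \<open>l\<close> does in row and column \<open>a\<close>. Coordinate
    \<open>n\<close> contributes exactly the term subtracted from \<open>k\<close> in
    \<open>l\<close>.\<close>
  define w where "w i x = (if i < n then if x = a then 0 else u i x else k a x / sqrt (k a a))" for i x
  have "k x y = (\<Sum>i<Suc n. w i x * w i y)" if "x \<in> insert a C" "y \<in> insert a C" for x y
  proof -
    have "(\<Sum>i<n. w i x * w i y) = l x y"
    proof (cases "x = a \<or> y = a")
      case True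
      then show ?thesis
        using l_a that by (auto simp: w_def)
    next
      case False
      then show ?thesis
        using that u by (simp add: w_def)
    qed
    moreover have "w n x * w n y = k a x * k a y / k a a"
      using kaa by (simp add: w_def)
    ultimately show ?thesis
      by (simp add: l_def)
  qed
  then show ?case by blast
qed

text \<open>The Schur product theorem: once \<open>k\<close> is a sum of rank one kernels, each term
  of the product is a rescaling of \<open>l\<close>.\<close>

lemma psd_kernel_mult:
  assumes "finite C" "psd_kernel C k" "psd_kernel C l"
  shows "psd_kernel C (\<lambda>x y. k x y * l x y)"
proof -
  obtain n :: nat and u where u: "\<And>x y. x \<in> C \<Longrightarrow> y \<in> C \<Longrightarrow> k x y = (\<Sum>i<n. u i x * u i y)"
    using psd_kernel_factor[OF assms(1,2)] by blast
  have "psd_kernel C (\<lambda>x y. \<Sum>i<n. u i x * u i y * l x y)"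
    by (intro psd_kernel_sum psd_kernel_rescale assms)
  then show ?thesis
    by (subst psd_kernel_cong[where l = "\<lambda>x y. \<Sum>i<n. u i x * u i y * l x y"])
      (simp_all add: u sum_distrib_right)
qed

text \<open>The exponential series has nonnegative coefficients, powers of \<open>k\<close> are
  Schur products, and positivity passes to the limit of the partial sums.\<close>

lemma psd_kernel_exp:
  assumes "finite C" "psd_kernel C k"
  shows "psd_kernel C (\<lambda>x y. exp (k x y))"
proof (rule psd_kernel_limit)
  have "psd_kernel C (\<lambda>x y. k x y ^ i)" for i
  proof (induction i)
    case 0
    then show ?case using psd_kernel_rank_one[of C "\<lambda>_. 1"] by simp
  next
    case (Suc i)
    then show ?case using psd_kernel_mult[OF assms] by simp
  qed
  then show "psd_kernel C (\<lambda>x y. \<Sum>i<m. inverse (fact i) * k x y ^ i)" for m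
    by (intro psd_kernel_sum psd_kernel_cmult) auto
  show "(\<lambda>m. \<Sum>i<m. inverse (fact i) * k x y ^ i) \<longlonglongrightarrow> exp (k x y)" for x y
    using exp_converges[of "k x y"] by (simp add: sums_def)
qed

text \<open>Expanding the squared norm exhibits the Gaussian as the exponential of the Gram kernel
  \<open>2 * t * inner (v x) (v y)\<close>, rescaled by a function of \<open>x\<close> and the same
  function of \<open>y\<close>.\<close>

lemma psd_kernel_gaussian:
  fixes v :: "'a \<Rightarrow> 'h::real_inner"
  assumes "finite C" "0 \<le> t"
  shows "psd_kernel C (\<lambda>x y. exp (- t * (norm (v x - v y))\<^sup>2))"
proof -
  have "psd_kernel C (\<lambda>x y. exp (- t * (norm (v x))\<^sup>2) * exp (- t * (norm (v y))\<^sup>2) *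
          exp (2 * t * inner (v x) (v y)))"
    using assms by (intro psd_kernel_rescale psd_kernel_exp psd_kernel_cmult psd_kernel_inner) auto
  moreover have "exp (- t * (norm (v x - v y))\<^sup>2) =
      exp (- t * (norm (v x))\<^sup>2) * exp (- t * (norm (v y))\<^sup>2) * exp (2 * t * inner (v x) (v y))" for x y
    by (simp add: power2_norm_eq_inner inner_diff_left inner_diff_right inner_commute algebra_simps
        flip: exp_add)
  ultimately show ?thesis by simp
qed

text \<open>The finite factorization of \<open>k\<close> is a Gram representation in Euclidean
  space. Padding with zeros moves it into \<open>ell2\<close>, whatever space \<open>k\<close> was
  built from.\<close>

lemma psd_kernel_ell2:
  assumes "finite C" "psd_kernel C k"
  shows "\<exists>f :: 'a \<Rightarrow> ell2. \<forall>x\<in>C. \<forall>y\<in>C. (norm (f x - f y))\<^sup>2 = k x x + k y y - 2 * k x y"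
proof -
  obtain n :: nat and u where u: "\<And>x y. x \<in> C \<Longrightarrow> y \<in> C \<Longrightarrow> k x y = (\<Sum>i<n. u i x * u i y)"
    using psd_kernel_factor[OF assms] by blast
  define f where "f x = Abs_ell2 (\<lambda>i. if i < n then u i x else 0)" for x
  have "summable (\<lambda>i. (if i < n then u i x else 0)\<^sup>2)" for x
    by (rule summable_finite[of "{..<n}"]) auto
  then have nth: "ell2_nth (f x) = (\<lambda>i. if i < n then u i x else 0)" for x
    by (simp add: f_def Abs_ell2_inverse)
  have "(norm (f x - f y))\<^sup>2 = k x x + k y y - 2 * k x y" if "x \<in> C" "y \<in> C" for x y
  proof -
    have "(norm (f x - f y))\<^sup>2 = (\<Sum>i<n. (u i x - u i y)\<^sup>2)"
      unfolding ell2_norm_power2 minus_ell2.rep_eq nth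
      by (subst suminf_finite[of "{..<n}"]) auto
    also have "\<dots> = k x x + k y y - 2 * k x y"
      by (simp add: u that power2_eq_square algebra_simps sum.distrib sum_subtractf
          sum_distrib_left)
    finally show ?thesis .
  qed
  then show ?thesis by blast
qed

section \<open>Coarse disjoint unions\<close>

lemma set_dist_le:
  assumes "\<And>x y. 0 \<le> d x y" "a \<in> A" "b \<in> B"
  shows "set_dist d A B \<le> d a b"
proof -
  have "bdd_below ((\<lambda>(a, b). d a b) ` (A \<times> B))"
    using assms(1) by (intro bdd_belowI2[where m = 0]) auto
  from cINF_lower[OF this, of "(a, b)"] show ?thesis
    using assms by (simp add: set_dist_def)
qed

lemma set_dist_attained:
  assumes "finite A" "finite B" "A \<noteq> {}" "B \<noteq> {}"
  shows "\<exists>a\<in>A. \<exists>b\<in>B. d a b = set_dist d A B"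
proof -
  have "set_dist d A B = Min ((\<lambda>(a, b). d a b) ` (A \<times> B))"
    unfolding set_dist_def using assms by (intro cInf_eq_Min) auto
  also have "\<dots> \<in> (\<lambda>(a, b). d a b) ` (A \<times> B)"
    using assms by (intro Min_in) auto
  finally show ?thesis by force
qed

text \<open>A bound on one index is enough, since \<open>k \<le> n\<close> gives
  \<open>k \<le> n + m\<close>. Asking for separation \<open>R + 1\<close> makes the inequality
  strict.\<close>

lemma coarse_disjoint_union_far:
  assumes "coarse_disjoint_union X \<delta> d"
  shows "\<exists>k. \<forall>n m x y. n \<noteq> m \<and> k \<le> n \<and> x \<in> X n \<and> y \<in> X m \<longrightarrow> R < d (n, x) (m, y)"
proof -
  interpret Metric_space "Sigma UNIV X" d
    using assms by (simp add: coarse_disjoint_union_def)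
  obtain k where k: "\<And>n m. n \<noteq> m \<Longrightarrow> k \<le> n + m \<Longrightarrow> R + 1 \<le> set_dist d ({n} \<times> X n) ({m} \<times> X m)"
    using assms unfolding coarse_disjoint_union_def by blast
  have "R < d (n, x) (m, y)" if "n \<noteq> m" "k \<le> n" "x \<in> X n" "y \<in> X m" for n m x y
    using k[of n m] set_dist_le[of d "(n, x)" "{n} \<times> X n" "(m, y)" "{m} \<times> X m"] that by simp
  then show ?thesis by blast
qed

text \<open>A bounded set lies in a ball around some \<open>(m, z)\<close>, and components far out
  are farther from \<open>z\<close> than its radius. The bound \<open>Suc m\<close> in the proof
  skips the component of the centre itself.\<close>

lemma coarse_disjoint_union_mbounded:
  assumes "coarse_disjoint_union X \<delta> d" "Metric_space.mbounded (Sigma UNIV X) d K"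
  shows "\<exists>k. \<forall>n\<ge>k. \<forall>x\<in>X n. (n, x) \<notin> K"
proof -
  interpret Metric_space "Sigma UNIV X" d
    using assms by (simp add: coarse_disjoint_union_def)
  obtain m z B where B: "K \<subseteq> mcball (m, z) B"
    using assms(2) by (auto simp: mbounded_def)
  obtain k where k: "\<And>n m x y. n \<noteq> m \<Longrightarrow> k \<le> n \<Longrightarrow> x \<in> X n \<Longrightarrow> y \<in> X m \<Longrightarrow> B < d (n, x) (m, y)"
    using coarse_disjoint_union_far[OF assms(1)] by blast
  have "(n, x) \<notin> K" if "max k (Suc m) \<le> n" "x \<in> X n" for n x
  proof
    assume "(n, x) \<in> K"
    then have "z \<in> X m" "d (n, x) (m, z) \<le> B"
      using B by (auto simp: commute)
    then show False
      using k[of n m x z] that by simp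
  qed
  then show ?thesis by blast
qed

section \<open>Reduction of the properties at infinity to single components\<close>

lemma Metric_space_component:
  assumes "coarse_disjoint_union X \<delta> d"
  shows "Metric_space (X n) (\<lambda>x y. d (n, x) (n, y))"
proof -
  interpret Metric_space "Sigma UNIV X" d
    using assms by (simp add: coarse_disjoint_union_def)
  show ?thesis
    by unfold_locales (auto simp: commute intro: triangle)
qed

lemma (in Metric_space) finite_imp_mbounded: "finite A \<Longrightarrow> A \<subseteq> M \<Longrightarrow> mbounded A"
  by (induction A rule: finite_induct) (auto simp: mbounded_insert)

text \<open>The common shape of both conditions at infinity. Bounded sets meet only finitely many
  components, and beyond some index a set of bounded diameter lies in one component, so the
  exceptional set becomes a bound on the index.\<close>

definition eventually_small_sets ::
    "(nat \<Rightarrow> 'a set) \<Rightarrow> (nat \<Rightarrow> 'a \<Rightarrow> 'a \<Rightarrow> real) \<Rightarrow> real \<Rightarrow> (nat \<Rightarrow> 'a set \<Rightarrow> bool) \<Rightarrow> bool" where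
  "eventually_small_sets X \<delta> L P \<longleftrightarrow>
     (\<exists>k. \<forall>n\<ge>k. \<forall>C\<subseteq>X n. (\<forall>x\<in>C. \<forall>y\<in>C. \<delta> n x y \<le> L) \<longrightarrow> P n C)"

lemma eventually_small_setsI:
  assumes "\<And>n C. k \<le> n \<Longrightarrow> C \<subseteq> X n \<Longrightarrow> (\<And>x y. x \<in> C \<Longrightarrow> y \<in> C \<Longrightarrow> \<delta> n x y \<le> L) \<Longrightarrow> P n C"
  shows "eventually_small_sets X \<delta> L P"
  unfolding eventually_small_sets_def
  by (rule exI[of _ k], intro allI impI, rule assms) auto

definition controlled ::
    "(real \<Rightarrow> real) \<Rightarrow> (real \<Rightarrow> real) \<Rightarrow> ('a \<Rightarrow> 'a \<Rightarrow> real) \<Rightarrow> 'a set \<Rightarrow> ('a \<Rightarrow> 'h::real_normed_vector) \<Rightarrow> bool" where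
  "controlled \<rho>\<^sub>1 \<rho>\<^sub>2 \<delta> C f \<longleftrightarrow> (\<forall>x\<in>C. \<forall>y\<in>C.
     \<rho>\<^sub>1 (\<delta> x y) \<le> norm (f x - f y) \<and> norm (f x - f y) \<le> \<rho>\<^sub>2 (\<delta> x y))"

lemma controlled_image:
  assumes "controlled \<rho>\<^sub>1 \<rho>\<^sub>2 d (g ` C) f" "\<And>x y. x \<in> C \<Longrightarrow> y \<in> C \<Longrightarrow> d (g x) (g y) = \<delta> x y"
  shows "controlled \<rho>\<^sub>1 \<rho>\<^sub>2 \<delta> C (\<lambda>x. f (g x))"
  using assms by (simp add: controlled_def)

lemma coarsely_embeds_at_infinityD:
  assumes cdu: "coarse_disjoint_union X \<delta> d" and fin: "\<And>n. finite (X n)"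
    and emb: "Metric_space.coarsely_embeds_at_infinity (Sigma UNIV X) d TYPE('h::{real_inner, complete_space})"
  obtains \<rho>\<^sub>1 \<rho>\<^sub>2 where "mono_on {0..} \<rho>\<^sub>2" "filterlim \<rho>\<^sub>1 at_top at_top"
    "\<forall>L. eventually_small_sets X \<delta> L (\<lambda>n C. \<exists>f :: 'a \<Rightarrow> 'h. controlled \<rho>\<^sub>1 \<rho>\<^sub>2 (\<delta> n) C f)"
proof -
  interpret Metric_space "Sigma UNIV X" d
    using cdu by (simp add: coarse_disjoint_union_def)
  have \<delta>: "d (n, x) (n, y) = \<delta> n x y" if "x \<in> X n" "y \<in> X n" for n x y
    using cdu that by (simp add: coarse_disjoint_union_def)
  from emb[unfolded coarsely_embeds_at_infinity_def, folded controlled_def] obtain \<rho>\<^sub>1 \<rho>\<^sub>2 where *: "\<forall>R>0. \<exists>K\<subseteq>Sigma UNIV X. mbounded K \<and>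
           (\<forall>C. C \<subseteq> Sigma UNIV X - K \<and> mbounded C \<and> (\<forall>x\<in>C. \<forall>y\<in>C. d x y \<le> R) \<longrightarrow>
              (\<exists>f :: nat \<times> 'a \<Rightarrow> 'h. controlled \<rho>\<^sub>1 \<rho>\<^sub>2 d C f))"
    and \<rho>: "mono_on {0..} \<rho>\<^sub>2" "filterlim \<rho>\<^sub>1 at_top at_top"
    by (elim exE conjE) (rule that)
  have "eventually_small_sets X \<delta> L (\<lambda>n C. \<exists>f :: 'a \<Rightarrow> 'h. controlled \<rho>\<^sub>1 \<rho>\<^sub>2 (\<delta> n) C f)" for L
  proof -
    \<comment> \<open>The embedding condition is stated for positive diameters only, whereas
      \<open>L\<close> is arbitrary.\<close>
    have "0 < max L 1" by simp
    from *[rule_format, OF this] obtain K where "mbounded K" and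
      K: "\<forall>C. C \<subseteq> Sigma UNIV X - K \<and> mbounded C \<and> (\<forall>x\<in>C. \<forall>y\<in>C. d x y \<le> max L 1) \<longrightarrow>
              (\<exists>f :: nat \<times> 'a \<Rightarrow> 'h. controlled \<rho>\<^sub>1 \<rho>\<^sub>2 d C f)"
      by (elim exE conjE) (rule that)
    obtain k where k: "\<And>n x. k \<le> n \<Longrightarrow> x \<in> X n \<Longrightarrow> (n, x) \<notin> K"
      using coarse_disjoint_union_mbounded[OF cdu \<open>mbounded K\<close>] by blast
    show ?thesis
    proof (rule eventually_small_setsI)
      fix n C
      assume "k \<le> n" and C: "C \<subseteq> X n" and le: "\<And>x y. x \<in> C \<Longrightarrow> y \<in> C \<Longrightarrow> \<delta> n x y \<le> L"
      have \<delta>C: "d (n, x) (n, y) = \<delta> n x y" if "x \<in> C" "y \<in> C" for x y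
        using \<delta> C that by blast
      have sub: "Pair n ` C \<subseteq> Sigma UNIV X - K"
        using k[OF \<open>k \<le> n\<close>] C by auto
      moreover have "mbounded (Pair n ` C)"
        using finite_subset[OF C fin] sub by (intro finite_imp_mbounded) auto
      moreover have "\<forall>x\<in>Pair n ` C. \<forall>y\<in>Pair n ` C. d x y \<le> max L 1"
        using le by (simp add: \<delta>C le_max_iff_disj)
      ultimately obtain f :: "nat \<times> 'a \<Rightarrow> 'h" where "controlled \<rho>\<^sub>1 \<rho>\<^sub>2 d (Pair n ` C) f"
        using K by blast
      then show "\<exists>f :: 'a \<Rightarrow> 'h. controlled \<rho>\<^sub>1 \<rho>\<^sub>2 (\<delta> n) C f"
        using controlled_image \<delta>C by blast
    qed
  qed
  then show ?thesis
    using \<rho> that by blast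
qed

text \<open>The exceptional set consists of the first finitely many components, chosen so that
  beyond them distinct components are more than \<open>R\<close> apart. A set of diameter at most
  \<open>R\<close> outside it then sits in one component.\<close>

lemma coarsely_embeds_at_infinityI:
  assumes cdu: "coarse_disjoint_union X \<delta> d" and fin: "\<And>n. finite (X n)"
    and \<rho>: "mono_on {0..} \<rho>\<^sub>1" "mono_on {0..} \<rho>\<^sub>2" "\<And>t. 0 \<le> t \<Longrightarrow> 0 \<le> \<rho>\<^sub>1 t" "\<And>t. 0 \<le> t \<Longrightarrow> 0 \<le> \<rho>\<^sub>2 t"
    "filterlim \<rho>\<^sub>1 at_top at_top" "filterlim \<rho>\<^sub>2 at_top at_top"
    and emb: "\<And>L. eventually_small_sets X \<delta> L (\<lambda>n C. \<exists>f :: 'a \<Rightarrow> 'h. controlled \<rho>\<^sub>1 \<rho>\<^sub>2 (\<delta> n) C f)"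
  shows "Metric_space.coarsely_embeds_at_infinity (Sigma UNIV X) d TYPE('h::{real_inner, complete_space})"
proof -
  interpret Metric_space "Sigma UNIV X" d
    using cdu by (simp add: coarse_disjoint_union_def)
  have \<delta>: "d (n, x) (n, y) = \<delta> n x y" if "x \<in> X n" "y \<in> X n" for n x y
    using cdu that by (simp add: coarse_disjoint_union_def)
  have "\<exists>K\<subseteq>Sigma UNIV X. mbounded K \<and>
           (\<forall>C. C \<subseteq> Sigma UNIV X - K \<and> mbounded C \<and> (\<forall>x\<in>C. \<forall>y\<in>C. d x y \<le> R) \<longrightarrow>
              (\<exists>f :: nat \<times> 'a \<Rightarrow> 'h. controlled \<rho>\<^sub>1 \<rho>\<^sub>2 d C f))" for R
  proof -
    obtain k where k: "\<forall>n\<ge>k. \<forall>C\<subseteq>X n. (\<forall>x\<in>C. \<forall>y\<in>C. \<delta> n x y \<le> R) \<longrightarrow>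
        (\<exists>f :: 'a \<Rightarrow> 'h. controlled \<rho>\<^sub>1 \<rho>\<^sub>2 (\<delta> n) C f)"
      using emb[of R] unfolding eventually_small_sets_def ..
    obtain l where l: "\<And>n m x y. n \<noteq> m \<Longrightarrow> l \<le> n \<Longrightarrow> x \<in> X n \<Longrightarrow> y \<in> X m \<Longrightarrow> R < d (n, x) (m, y)"
      using coarse_disjoint_union_far[OF cdu] by blast
    define K where "K = Sigma {..max k l} X"
    have "\<exists>f :: nat \<times> 'a \<Rightarrow> 'h. controlled \<rho>\<^sub>1 \<rho>\<^sub>2 d C f"
      if C: "C \<subseteq> Sigma UNIV X - K" and le: "\<forall>x\<in>C. \<forall>y\<in>C. d x y \<le> R" for C
    proof (cases "C = {}")
      case True
      then show ?thesis
        by (simp add: controlled_def)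
    next
      case False
      then obtain n z where z: "(n, z) \<in> C" by auto
      then have n: "k \<le> n" "l \<le> n" "z \<in> X n"
        using C by (auto simp: K_def)
      have in_n: "m = n \<and> y \<in> X n" if "(m, y) \<in> C" for m y
      proof -
        have "y \<in> X m"
          using that C by auto
        moreover have "d (n, z) (m, y) \<le> R"
          using le z that by blast
        ultimately show ?thesis
          using l[of n m z y] n by force
      qed
      define D where "D = snd ` C"
      have C_eq: "C = Pair n ` D"
        using in_n by (force simp: D_def)
      have D: "D \<subseteq> X n"
        using in_n unfolding D_def by (intro image_subsetI) (metis prod.collapse)
      have \<delta>D: "d (n, x) (n, y) = \<delta> n x y" if "x \<in> D" "y \<in> D" for x y
        using \<delta> D that by blast
      obtain f :: "'a \<Rightarrow> 'h" where f: "controlled \<rho>\<^sub>1 \<rho>\<^sub>2 (\<delta> n) D f"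
      proof -
        have "\<forall>x\<in>D. \<forall>y\<in>D. \<delta> n x y \<le> R"
          using le by (simp add: C_eq \<delta>D)
        then show thesis
          using k n(1) D that by blast
      qed
      have "controlled \<rho>\<^sub>1 \<rho>\<^sub>2 d C (\<lambda>p. f (snd p))"
        using f by (simp add: C_eq controlled_def \<delta>D)
      then show ?thesis by blast
    qed
    then have "\<forall>C. C \<subseteq> Sigma UNIV X - K \<and> mbounded C \<and> (\<forall>x\<in>C. \<forall>y\<in>C. d x y \<le> R) \<longrightarrow>
        (\<exists>f :: nat \<times> 'a \<Rightarrow> 'h. controlled \<rho>\<^sub>1 \<rho>\<^sub>2 d C f)"
      by simp
    moreover have "K \<subseteq> Sigma UNIV X" "mbounded K"
      using fin by (auto simp: K_def intro!: finite_imp_mbounded)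
    ultimately show ?thesis
      by (intro exI[of _ K] conjI)
  qed
  with \<rho> show ?thesis
    unfolding coarsely_embeds_at_infinity_def controlled_def
    by (intro exI[of _ \<rho>\<^sub>1] exI[of _ \<rho>\<^sub>2] conjI allI impI) assumption+
qed

definition A_map ::
    "real \<Rightarrow> real \<Rightarrow> real \<Rightarrow> ('a \<Rightarrow> 'a \<Rightarrow> real) \<Rightarrow> 'a set \<Rightarrow> ('a \<Rightarrow> 'a \<Rightarrow> complex) \<Rightarrow> bool" where
  "A_map R \<epsilon> S \<delta> C \<xi> \<longleftrightarrow>
     (\<forall>x\<in>C. L2_set (\<lambda>z. cmod (\<xi> x z)) C = 1) \<and>
     (\<forall>x\<in>C. \<forall>y\<in>C. \<delta> x y \<le> R \<longrightarrow> cmod (1 - (\<Sum>z\<in>C. \<xi> x z * cnj (\<xi> y z))) \<le> \<epsilon>) \<and>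
     (\<forall>x\<in>C. \<forall>z\<in>C. \<xi> x z \<noteq> 0 \<longrightarrow> \<delta> x z \<le> S)"

lemma A_map_image:
  assumes A: "A_map R \<epsilon> S d (g ` C) \<xi>" and "inj_on g C"
    and d: "\<And>x y. x \<in> C \<Longrightarrow> y \<in> C \<Longrightarrow> d (g x) (g y) = \<delta> x y"
  shows "A_map R \<epsilon> S \<delta> C (\<lambda>x z. \<xi> (g x) (g z))"
  using A unfolding A_map_def L2_set_def
  by (simp add: sum.reindex[OF \<open>inj_on g C\<close>] d)

text \<open>The order of quantifiers matters: \<open>S\<close> is fixed before \<open>L\<close>, so
  one support radius serves all diameters, and only the index bound depends on
  \<open>L\<close>.\<close>

lemma property_A_at_infinityD:
  assumes cdu: "coarse_disjoint_union X \<delta> d" and fin: "\<And>n. finite (X n)"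
    and A: "Metric_space.property_A_at_infinity (Sigma UNIV X) d" and "0 < R" "0 < \<epsilon>"
  obtains S where "\<forall>L. eventually_small_sets X \<delta> L (\<lambda>n C. \<exists>\<xi>. A_map R \<epsilon> S (\<delta> n) C \<xi>)"
proof -
  interpret Metric_space "Sigma UNIV X" d
    using cdu by (simp add: coarse_disjoint_union_def)
  have \<delta>: "d (n, x) (n, y) = \<delta> n x y" if "x \<in> X n" "y \<in> X n" for n x y
    using cdu that by (simp add: coarse_disjoint_union_def)
  have "\<exists>S\<ge>0. \<forall>L\<ge>0. \<exists>K\<subseteq>Sigma UNIV X. finite K \<and>
        (\<forall>C. C \<subseteq> Sigma UNIV X - K \<and> finite C \<and> (\<forall>x\<in>C. \<forall>y\<in>C. d x y \<le> L) \<longrightarrow>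
           (\<exists>\<xi> :: nat \<times> 'a \<Rightarrow> nat \<times> 'a \<Rightarrow> complex.
              (\<forall>x\<in>C. L2_set (\<lambda>z. cmod (\<xi> x z)) C = 1) \<and>
              (\<forall>x\<in>C. \<forall>y\<in>C. d x y \<le> R \<longrightarrow> cmod (1 - (\<Sum>z\<in>C. \<xi> x z * cnj (\<xi> y z))) \<le> \<epsilon>) \<and>
              (\<forall>x\<in>C. {z \<in> C. \<xi> x z \<noteq> 0} \<subseteq> mcball x S)))"
    using A[unfolded property_A_at_infinity_def, THEN conjunct2, THEN conjunct2] \<open>0 < R\<close> \<open>0 < \<epsilon>\<close>
    by simp
  then obtain S where S: "\<forall>L\<ge>0. \<exists>K\<subseteq>Sigma UNIV X. finite K \<and>
        (\<forall>C. C \<subseteq> Sigma UNIV X - K \<and> finite C \<and> (\<forall>x\<in>C. \<forall>y\<in>C. d x y \<le> L) \<longrightarrow>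
           (\<exists>\<xi> :: nat \<times> 'a \<Rightarrow> nat \<times> 'a \<Rightarrow> complex.
              (\<forall>x\<in>C. L2_set (\<lambda>z. cmod (\<xi> x z)) C = 1) \<and>
              (\<forall>x\<in>C. \<forall>y\<in>C. d x y \<le> R \<longrightarrow> cmod (1 - (\<Sum>z\<in>C. \<xi> x z * cnj (\<xi> y z))) \<le> \<epsilon>) \<and>
              (\<forall>x\<in>C. {z \<in> C. \<xi> x z \<noteq> 0} \<subseteq> mcball x S)))"
    by (elim exE conjE) (rule that)
  have "eventually_small_sets X \<delta> L (\<lambda>n C. \<exists>\<xi>. A_map R \<epsilon> S (\<delta> n) C \<xi>)" for L
  proof -
    have "0 \<le> max L 0" by simp
    from S[rule_format, OF this] obtain K where "finite K" and
      K: "\<forall>C. C \<subseteq> Sigma UNIV X - K \<and> finite C \<and> (\<forall>x\<in>C. \<forall>y\<in>C. d x y \<le> max L 0) \<longrightarrow>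
           (\<exists>\<xi> :: nat \<times> 'a \<Rightarrow> nat \<times> 'a \<Rightarrow> complex.
              (\<forall>x\<in>C. L2_set (\<lambda>z. cmod (\<xi> x z)) C = 1) \<and>
              (\<forall>x\<in>C. \<forall>y\<in>C. d x y \<le> R \<longrightarrow> cmod (1 - (\<Sum>z\<in>C. \<xi> x z * cnj (\<xi> y z))) \<le> \<epsilon>) \<and>
              (\<forall>x\<in>C. {z \<in> C. \<xi> x z \<noteq> 0} \<subseteq> mcball x S))"
      by (elim exE conjE) (rule that)
    have "finite (fst ` K)"
      using \<open>finite K\<close> by simp
    then obtain k where k: "\<And>n. k \<le> n \<Longrightarrow> n \<notin> fst ` K"
      using finite_nat_set_iff_bounded by (meson leD)
    show ?thesis
    proof (rule eventually_small_setsI)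
      fix n C
      assume "k \<le> n" and C: "C \<subseteq> X n" and le: "\<And>x y. x \<in> C \<Longrightarrow> y \<in> C \<Longrightarrow> \<delta> n x y \<le> L"
      have \<delta>C: "d (n, x) (n, y) = \<delta> n x y" if "x \<in> C" "y \<in> C" for x y
        using \<delta> C that by blast
      have 1: "Pair n ` C \<subseteq> Sigma UNIV X - K"
        using k[OF \<open>k \<le> n\<close>] C by (auto simp: image_iff)
      have 2: "finite (Pair n ` C)"
        using finite_subset[OF C fin] by simp
      have 3: "\<forall>x\<in>Pair n ` C. \<forall>y\<in>Pair n ` C. d x y \<le> max L 0"
        using le by (simp add: \<delta>C le_max_iff_disj)
      from K[THEN spec, THEN mp, OF conjI[OF 1 conjI[OF 2 3]]] obtain \<xi> :: "nat \<times> 'a \<Rightarrow> nat \<times> 'a \<Rightarrow> complex" where \<xi>: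
          "\<forall>x\<in>Pair n ` C. L2_set (\<lambda>z. cmod (\<xi> x z)) (Pair n ` C) = 1"
          "\<forall>x\<in>Pair n ` C. \<forall>y\<in>Pair n ` C. d x y \<le> R \<longrightarrow>
              cmod (1 - (\<Sum>z\<in>Pair n ` C. \<xi> x z * cnj (\<xi> y z))) \<le> \<epsilon>"
          "\<forall>x\<in>Pair n ` C. {z \<in> Pair n ` C. \<xi> x z \<noteq> 0} \<subseteq> mcball x S"
        by (elim exE conjE) (rule that)
      have "A_map R \<epsilon> S d (Pair n ` C) \<xi>"
        unfolding A_map_def using \<xi> by (simp add: subset_iff)
      then have "A_map R \<epsilon> S (\<delta> n) C (\<lambda>x z. \<xi> (n, x) (n, z))"
        by (rule A_map_image) (simp_all add: \<delta>C inj_on_def)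
      then show "\<exists>\<xi>. A_map R \<epsilon> S (\<delta> n) C \<xi>" by blast
    qed
  qed
  then show ?thesis
    using that by blast
qed

section \<open>Coarse embeddings from kernels\<close>

lemma finite_sublevel:
  fixes T :: "nat \<Rightarrow> real"
  assumes "\<And>j. real j \<le> T j"
  shows "finite {j. T j \<le> t}"
proof (rule finite_subset)
  show "{j. T j \<le> t} \<subseteq> {..nat \<lceil>t\<rceil>}"
  proof
    fix j assume "j \<in> {j. T j \<le> t}"
    then have "real j \<le> t"
      using assms[of j] by simp
    then show "j \<in> {..nat \<lceil>t\<rceil>}"
      by simp linarith
  qed
qed simp

text \<open>The number of thresholds \<open>T j\<close> passed by \<open>t\<close> is finite because
  \<open>T j\<close> is at least \<open>j\<close>, and it is at least \<open>m\<close> once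
  \<open>t\<close> passes the first \<open>m\<close> thresholds.\<close>

lemma filterlim_sqrt_card_at_top:
  fixes T :: "nat \<Rightarrow> real"
  assumes "\<And>j. real j \<le> T j"
  shows "filterlim (\<lambda>t. sqrt (real (card {j. T j \<le> t}))) at_top at_top"
proof (rule filterlim_compose[OF sqrt_at_top], rule filterlim_compose[OF filterlim_real_sequentially])
  have "m \<le> card {j. T j \<le> t}" if "Max (insert 0 (T ` {..<m})) \<le> t" for m t
  proof -
    have "{..<m} \<subseteq> {j. T j \<le> t}"
      using that by auto
    then have "card {..<m} \<le> card {j. T j \<le> t}"
      by (intro card_mono finite_sublevel assms)
    then show ?thesis by simp
  qed
  then show "filterlim (\<lambda>t. card {j. T j \<le> t}) at_top at_top"
    unfolding filterlim_at_top eventually_at_top_linorder by blast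
qed

text \<open>For the feature map of such a kernel the squared distance of the images is
  \<open>2 - 2 * K x y\<close>: at most \<open>2 * \<epsilon>\<close> up to distance
  \<open>R\<close>, at least 1 beyond \<open>T\<close>, and never more than 4.\<close>

definition separating_kernel ::
    "real \<Rightarrow> real \<Rightarrow> real \<Rightarrow> ('a \<Rightarrow> 'a \<Rightarrow> real) \<Rightarrow> 'a set \<Rightarrow> ('a \<Rightarrow> 'a \<Rightarrow> real) \<Rightarrow> bool" where
  "separating_kernel R \<epsilon> T \<delta> C K \<longleftrightarrow> psd_kernel C K \<and> (\<forall>x\<in>C. K x x = 1) \<and>
     (\<forall>x\<in>C. \<forall>y\<in>C. \<bar>K x y\<bar> \<le> 1 \<and> (\<delta> x y \<le> R \<longrightarrow> 1 - K x y \<le> \<epsilon>) \<and> (T \<le> \<delta> x y \<longrightarrow> K x y \<le> 1 / 2))"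

lemma coarsely_embeds_at_infinity_of_kernels:
  assumes cdu: "coarse_disjoint_union X \<delta> d" and fin: "\<And>n. finite (X n)"
    and ker: "\<And>R \<epsilon>. 0 < R \<Longrightarrow> 0 < \<epsilon> \<Longrightarrow>
      \<exists>T. \<forall>L. eventually_small_sets X \<delta> L (\<lambda>n C. \<exists>K. separating_kernel R \<epsilon> T (\<delta> n) C K)"
  shows "Metric_space.coarsely_embeds_at_infinity (Sigma UNIV X) d TYPE(ell2)"
proof -
  interpret Metric_space "Sigma UNIV X" d
    using cdu by (simp add: coarse_disjoint_union_def)
  have \<delta>: "d (n, x) (n, y) = \<delta> n x y" if "x \<in> X n" "y \<in> X n" for n x y
    using cdu that by (simp add: coarse_disjoint_union_def)
  have "\<forall>j. \<exists>T. \<forall>L. eventually_small_sets X \<delta> L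
      (\<lambda>n C. \<exists>K. separating_kernel (real (Suc j)) ((1/2)^j) T (\<delta> n) C K)"
    by (intro allI ker) auto
  from choice[OF this] obtain T0 where T0: "\<forall>j L. eventually_small_sets X \<delta> L
      (\<lambda>n C. \<exists>K. separating_kernel (real (Suc j)) ((1/2)^j) (T0 j) (\<delta> n) C K)" ..
  \<comment> \<open>Raising the threshold to at least \<open>j\<close> makes only finitely many
    thresholds lie below a given distance. The kernels separate at \<open>T j\<close> because they
    already do at \<open>T0 j\<close>.\<close>
  define T where "T j = max (T0 j) (real j)" for j
  have T_ge: "real j \<le> T j" for j
    by (simp add: T_def)
  define \<rho>\<^sub>1 where "\<rho>\<^sub>1 t = sqrt (real (card {j. T j \<le> t}))" for t
  \<comment> \<open>Under the root, \<open>4 * t\<close> pays for the at most \<open>t\<close>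
    indices with \<open>real (Suc j) < t\<close>, each contributing at most 4. The constant 4 bounds
    the sum of \<open>2 * (1/2)^j\<close>.\<close>
  define \<rho>\<^sub>2 where "\<rho>\<^sub>2 t = sqrt (4 * t + 4)" for t :: real
  show ?thesis
  proof (rule coarsely_embeds_at_infinityI[OF cdu fin, where \<rho>\<^sub>1 = \<rho>\<^sub>1 and \<rho>\<^sub>2 = \<rho>\<^sub>2])
    show "mono_on {0..} \<rho>\<^sub>1"
      by (auto simp: mono_on_def \<rho>\<^sub>1_def intro!: card_mono finite_sublevel T_ge)
    show "mono_on {0..} \<rho>\<^sub>2"
      by (auto simp: mono_on_def \<rho>\<^sub>2_def)
    show "0 \<le> \<rho>\<^sub>1 t" "0 \<le> t \<Longrightarrow> 0 \<le> \<rho>\<^sub>2 t" for t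
      by (simp_all add: \<rho>\<^sub>1_def \<rho>\<^sub>2_def)
    show "filterlim \<rho>\<^sub>1 at_top at_top"
      unfolding \<rho>\<^sub>1_def by (rule filterlim_sqrt_card_at_top[OF T_ge])
    show "filterlim \<rho>\<^sub>2 at_top at_top"
      unfolding \<rho>\<^sub>2_def by real_asymp
  next
    fix L
    have "\<forall>j. \<exists>k. \<forall>n\<ge>k. \<forall>C\<subseteq>X n. (\<forall>x\<in>C. \<forall>y\<in>C. \<delta> n x y \<le> L) \<longrightarrow>
      (\<exists>K. separating_kernel (real (Suc j)) ((1/2)^j) (T0 j) (\<delta> n) C K)"
      using T0 unfolding eventually_small_sets_def by blast
    from choice[OF this] obtain \<kappa> where
      \<kappa>: "\<forall>j. \<forall>n\<ge>\<kappa> j. \<forall>C\<subseteq>X n. (\<forall>x\<in>C. \<forall>y\<in>C. \<delta> n x y \<le> L) \<longrightarrow>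
        (\<exists>K. separating_kernel (real (Suc j)) ((1/2)^j) (T0 j) (\<delta> n) C K)" ..
    \<comment> \<open>If \<open>T j \<le> t\<close> and \<open>t \<le> L\<close>, then
      \<open>j \<le> L\<close> and so \<open>j < J\<close>. Truncating the sum at \<open>J\<close>
      therefore loses nothing from the lower bound, and \<open>\<rho>\<^sub>1\<close> is independent
      of \<open>L\<close>.\<close>
    define J where "J = Suc (nat \<lceil>L\<rceil>)"
    show "eventually_small_sets X \<delta> L (\<lambda>n C. \<exists>f :: 'a \<Rightarrow> ell2. controlled \<rho>\<^sub>1 \<rho>\<^sub>2 (\<delta> n) C f)"
    proof (rule eventually_small_setsI)
      fix n C
      assume "Max (\<kappa> ` {..<J}) \<le> n" and C: "C \<subseteq> X n"
        and le: "\<And>x y. x \<in> C \<Longrightarrow> y \<in> C \<Longrightarrow> \<delta> n x y \<le> L"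
      have "\<kappa> j \<le> Max (\<kappa> ` {..<J})" if "j < J" for j
        using that by (intro Max_ge) auto
      with \<open>Max (\<kappa> ` {..<J}) \<le> n\<close> have "\<kappa> j \<le> n" if "j < J" for j
        using that order_trans by blast
      then have "\<forall>j. \<exists>K. j < J \<longrightarrow> separating_kernel (real (Suc j)) ((1/2)^j) (T0 j) (\<delta> n) C K"
        using \<kappa> C le by blast
      from choice[OF this] obtain K where
        sep: "\<forall>j. j < J \<longrightarrow> separating_kernel (real (Suc j)) ((1/2)^j) (T0 j) (\<delta> n) C (K j)" ..
      have K: "psd_kernel C (K j)" "x \<in> C \<Longrightarrow> K j x x = 1"
        "x \<in> C \<Longrightarrow> y \<in> C \<Longrightarrow> \<bar>K j x y\<bar> \<le> 1"
        "x \<in> C \<Longrightarrow> y \<in> C \<Longrightarrow> \<delta> n x y \<le> real (Suc j) \<Longrightarrow> 1 - K j x y \<le> (1/2)^j"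
        "x \<in> C \<Longrightarrow> y \<in> C \<Longrightarrow> T0 j \<le> \<delta> n x y \<Longrightarrow> K j x y \<le> 1 / 2" if "j < J" for j x y
        using sep[rule_format, OF that] unfolding separating_kernel_def by blast+
      have "finite C"
        using C fin finite_subset by blast
      moreover have "psd_kernel C (\<lambda>x y. \<Sum>j<J. K j x y)"
        by (rule psd_kernel_sum) (simp add: K)
      ultimately obtain f :: "'a \<Rightarrow> ell2" where "\<forall>x\<in>C. \<forall>y\<in>C. (norm (f x - f y))\<^sup>2 =
          (\<Sum>j<J. K j x x) + (\<Sum>j<J. K j y y) - 2 * (\<Sum>j<J. K j x y)"
        by (meson psd_kernel_ell2)
      then have f: "(norm (f x - f y))\<^sup>2 = (\<Sum>j<J. 2 - 2 * K j x y)" if "x \<in> C" "y \<in> C" for x y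
        using that by (simp add: K sum_subtractf sum_distrib_left)
      have "\<rho>\<^sub>1 (\<delta> n x y) \<le> norm (f x - f y) \<and> norm (f x - f y) \<le> \<rho>\<^sub>2 (\<delta> n x y)"
        if xy: "x \<in> C" "y \<in> C" for x y
      proof -
        define t where "t = \<delta> n x y"
        have "t \<le> L"
          using le xy by (simp add: t_def)
        have "x \<in> X n" "y \<in> X n"
          using C xy by auto
        then have "0 \<le> t"
          using nonneg[of "(n, x)" "(n, y)"] by (simp add: t_def \<delta>)
        have sub: "{j. T j \<le> t} \<subseteq> {..<J}"
        proof
          fix j assume "j \<in> {j. T j \<le> t}"
          then have "real j \<le> L"
            using T_ge[of j] \<open>t \<le> L\<close> by simp
          then show "j \<in> {..<J}"
            unfolding J_def by simp linarith
        qed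
        have "real (card {j. T j \<le> t}) = (\<Sum>j\<in>{j. T j \<le> t}. 1)"
          by simp
        also have "\<dots> \<le> (\<Sum>j\<in>{j. T j \<le> t}. 2 - 2 * K j x y)"
        proof (rule sum_mono)
          fix j assume "j \<in> {j. T j \<le> t}"
          with sub have "j < J" "T0 j \<le> \<delta> n x y"
            by (auto simp: T_def t_def)
          with K(5)[of j x y] xy show "1 \<le> 2 - 2 * K j x y"
            by simp
        qed
        also have "\<dots> \<le> (\<Sum>j<J. 2 - 2 * K j x y)"
        proof (rule sum_mono2[OF _ sub])
          fix j assume "j \<in> {..<J} - {j. T j \<le> t}"
          then show "0 \<le> 2 - 2 * K j x y"
            using K(3)[of j x y] xy by auto
        qed simp
        finally have 1: "\<rho>\<^sub>1 t \<le> norm (f x - f y)"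
          using f[OF xy] by (auto simp: \<rho>\<^sub>1_def intro: real_le_lsqrt)
        \<comment> \<open>For \<open>real (Suc j) < t\<close> only
          \<open>\<bar>K j x y\<bar> \<le> 1\<close> is available. For the other indices the pair is
          within the range where \<open>K j\<close> is close to 1.\<close>
        have "(norm (f x - f y))\<^sup>2 \<le> (\<Sum>j<J. (if real (Suc j) < t then 4 else 0) + 2 * (1/2)^j)"
          unfolding f[OF xy]
        proof (rule sum_mono)
          fix j assume "j \<in> {..<J}"
          then have "j < J" by simp
          have "0 \<le> (1/2::real)^j" by simp
          then have "2 - 2 * K j x y \<le> 4 + 2 * (1/2)^j"
            using K(3)[OF \<open>j < J\<close> xy] by linarith
          moreover have "2 - 2 * K j x y \<le> 2 * (1/2)^j" if "t \<le> real (Suc j)"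
            using K(4)[OF \<open>j < J\<close> xy] that unfolding t_def by linarith
          ultimately show "2 - 2 * K j x y \<le> (if real (Suc j) < t then 4 else 0) + 2 * (1/2)^j"
            by (cases "real (Suc j) < t") (simp_all only: if_P if_not_P not_less not_le add_0)
        qed
        also have "\<dots> = 4 * real (card {j \<in> {..<J}. real (Suc j) < t}) + 2 * (\<Sum>j<J. (1/2)^j)"
          by (simp add: sum.distrib sum_distrib_left sum.If_cases Int_def)
        also have "\<dots> \<le> 4 * t + 2 * 2"
        proof (intro add_mono mult_left_mono)
          have "{j \<in> {..<J}. real (Suc j) < t} \<subseteq> {..<nat \<lfloor>t\<rfloor>}"
          proof
            fix j assume "j \<in> {j \<in> {..<J}. real (Suc j) < t}"
            then have "int (Suc j) \<le> \<lfloor>t\<rfloor>"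
              by (simp add: le_floor_iff)
            then show "j \<in> {..<nat \<lfloor>t\<rfloor>}"
              by simp
          qed
          then have "card {j \<in> {..<J}. real (Suc j) < t} \<le> nat \<lfloor>t\<rfloor>"
            using card_mono[OF finite_lessThan] by (metis card_lessThan)
          then show "real (card {j \<in> {..<J}. real (Suc j) < t}) \<le> t"
            using \<open>0 \<le> t\<close> by linarith
          show "(\<Sum>j<J. (1/2)^j) \<le> (2::real)"
            by (simp add: geometric_sum)
        qed simp_all
        finally have "norm (f x - f y) \<le> \<rho>\<^sub>2 t"
          by (auto simp: \<rho>\<^sub>2_def intro: real_le_rsqrt)
        with 1 show ?thesis
          by (simp add: t_def)
      qed
      then show "\<exists>f :: 'a \<Rightarrow> ell2. controlled \<rho>\<^sub>1 \<rho>\<^sub>2 (\<delta> n) C f"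
        unfolding controlled_def by blast
    qed
  qed
qed

section \<open>Gluing fibre embeddings by Property A vectors\<close>

text \<open>By Cauchy-Schwarz the weights \<open>w x y q\<close> have total absolute value at most 1
  over \<open>q\<close>. A weighted sum of factors is thus bounded by any bound for them on the
  common support of \<open>\<xi> x\<close> and \<open>\<xi> y\<close>, which is where
  \<open>upper\<close> and \<open>lower\<close> speak.\<close>

lemma glued_kernel:
  fixes \<xi> :: "'a \<Rightarrow> 'q \<Rightarrow> complex" and v :: "'q \<Rightarrow> 'a \<Rightarrow> 'h::real_inner"
    and \<delta> :: "'a \<Rightarrow> 'a \<Rightarrow> real"
  assumes "finite C" "finite P" "0 \<le> t" "0 \<le> B" "exp (- t * B\<^sup>2) \<le> 1 / 2"
    and unit: "\<And>x. x \<in> C \<Longrightarrow> L2_set (\<lambda>q. cmod (\<xi> x q)) P = 1"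
    and near: "\<And>x y. x \<in> C \<Longrightarrow> y \<in> C \<Longrightarrow> \<delta> x y \<le> R \<Longrightarrow>
      cmod (1 - (\<Sum>q\<in>P. \<xi> x q * cnj (\<xi> y q))) \<le> \<epsilon>"
    and upper: "\<And>x y q. x \<in> C \<Longrightarrow> y \<in> C \<Longrightarrow> q \<in> P \<Longrightarrow> \<delta> x y \<le> R \<Longrightarrow> \<xi> x q \<noteq> 0 \<Longrightarrow> \<xi> y q \<noteq> 0 \<Longrightarrow>
      norm (v q x - v q y) \<le> A"
    and lower: "\<And>x y q. x \<in> C \<Longrightarrow> y \<in> C \<Longrightarrow> q \<in> P \<Longrightarrow> T \<le> \<delta> x y \<Longrightarrow> \<xi> x q \<noteq> 0 \<Longrightarrow> \<xi> y q \<noteq> 0 \<Longrightarrow>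
      B \<le> norm (v q x - v q y)"
  shows "\<exists>K. separating_kernel R (\<epsilon> + t * A\<^sup>2) T \<delta> C K"
proof -
  define w where "w x y q = Re (\<xi> x q * cnj (\<xi> y q))" for x y q
  define E where "E x y q = exp (- t * (norm (v q x - v q y))\<^sup>2)" for x y q
  define K where "K x y = (\<Sum>q\<in>P. w x y q * E x y q)" for x y
  have E: "0 \<le> E x y q" "E x y q \<le> 1" for x y q
    using \<open>0 \<le> t\<close> by (simp_all add: E_def)
  have bound: "\<bar>\<Sum>q\<in>P. w x y q * e q\<bar> \<le> m"
    if xy: "x \<in> C" "y \<in> C" and "0 \<le> m"
      and m: "\<And>q. q \<in> P \<Longrightarrow> \<xi> x q \<noteq> 0 \<Longrightarrow> \<xi> y q \<noteq> 0 \<Longrightarrow> \<bar>e q\<bar> \<le> m" for x y e m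
  proof -
    have "\<bar>\<Sum>q\<in>P. w x y q * e q\<bar> \<le> (\<Sum>q\<in>P. \<bar>w x y q * e q\<bar>)"
      by (rule sum_abs)
    also have "\<dots> \<le> (\<Sum>q\<in>P. m * (\<bar>cmod (\<xi> x q)\<bar> * \<bar>cmod (\<xi> y q)\<bar>))"
    proof (rule sum_mono)
      fix q assume "q \<in> P"
      have "\<bar>w x y q\<bar> \<le> cmod (\<xi> x q) * cmod (\<xi> y q)"
        using abs_Re_le_cmod[of "\<xi> x q * cnj (\<xi> y q)"] by (simp add: w_def norm_mult)
      then show "\<bar>w x y q * e q\<bar> \<le> m * (\<bar>cmod (\<xi> x q)\<bar> * \<bar>cmod (\<xi> y q)\<bar>)"
        using m[OF \<open>q \<in> P\<close>] \<open>0 \<le> m\<close>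
        by (cases "\<xi> x q = 0 \<or> \<xi> y q = 0")
          (auto simp: w_def abs_mult mult.commute[of m] intro: mult_mono)
    qed
    also have "\<dots> = m * (\<Sum>q\<in>P. \<bar>cmod (\<xi> x q)\<bar> * \<bar>cmod (\<xi> y q)\<bar>)"
      by (simp add: sum_distrib_left)
    also have "\<dots> \<le> m * (L2_set (\<lambda>q. cmod (\<xi> x q)) P * L2_set (\<lambda>q. cmod (\<xi> y q)) P)"
      using \<open>0 \<le> m\<close> by (intro mult_left_mono L2_set_mult_ineq)
    finally show ?thesis
      using unit xy by simp
  qed
  \<comment> \<open>The real part of \<open>\<xi> x q * cnj (\<xi> y q)\<close> is the sum of two
    rank one kernels, one from real and one from imaginary parts. Each is multiplied by a
    Gaussian.\<close>
  have "psd_kernel C (\<lambda>x y. \<Sum>q\<in>P. (Re (\<xi> x q) * Re (\<xi> y q) + Im (\<xi> x q) * Im (\<xi> y q)) * E x y q)"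
    unfolding E_def using assms(1,3)
    by (intro psd_kernel_sum psd_kernel_mult psd_kernel_add psd_kernel_rank_one psd_kernel_gaussian)
  then have "psd_kernel C K"
    by (simp add: K_def[abs_def] w_def)
  moreover have "K x x = 1" if "x \<in> C" for x
  proof -
    have "w x x q = (cmod (\<xi> x q))\<^sup>2" for q
      by (simp add: w_def cmod_power2 flip: power2_eq_square)
    then have "K x x = (L2_set (\<lambda>q. cmod (\<xi> x q)) P)\<^sup>2"
      by (simp add: K_def E_def L2_set_def sum_nonneg)
    then show ?thesis
      using unit that by simp
  qed
  moreover have "\<bar>K x y\<bar> \<le> 1" if "x \<in> C" "y \<in> C" for x y
    unfolding K_def using that E by (intro bound) auto
  moreover have "1 - K x y \<le> \<epsilon> + t * A\<^sup>2" if xy: "x \<in> C" "y \<in> C" "\<delta> x y \<le> R" for x y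
  proof -
    \<comment> \<open>The defect \<open>1 - K x y\<close> splits into 1 minus the sum of the
      weights, at most \<open>\<epsilon>\<close> by \<open>near\<close>, and this weighted sum,
      where \<open>1 - exp (- u) \<le> u\<close> applies.\<close>
    have "\<bar>\<Sum>q\<in>P. w x y q * (1 - E x y q)\<bar> \<le> t * A\<^sup>2"
    proof (rule bound[OF xy(1,2)])
      fix q assume "q \<in> P" "\<xi> x q \<noteq> 0" "\<xi> y q \<noteq> 0"
      then have "(norm (v q x - v q y))\<^sup>2 \<le> A\<^sup>2"
        using upper xy by (intro power_mono) auto
      then have "t * (norm (v q x - v q y))\<^sup>2 \<le> t * A\<^sup>2"
        using \<open>0 \<le> t\<close> by (rule mult_left_mono)
      moreover have "1 - t * (norm (v q x - v q y))\<^sup>2 \<le> E x y q"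
        using exp_ge_add_one_self[of "- t * (norm (v q x - v q y))\<^sup>2"] by (simp add: E_def)
      ultimately show "\<bar>1 - E x y q\<bar> \<le> t * A\<^sup>2"
        using E(2)[of x y q] by linarith
    qed (use \<open>0 \<le> t\<close> in simp)
    moreover have "1 - (\<Sum>q\<in>P. w x y q) \<le> \<epsilon>"
      using near[OF xy] complex_Re_le_cmod[of "1 - (\<Sum>q\<in>P. \<xi> x q * cnj (\<xi> y q))"]
      unfolding w_def by (simp only: minus_complex.sel one_complex.sel Re_sum)
    moreover have "(\<Sum>q\<in>P. w x y q * (1 - E x y q)) = (\<Sum>q\<in>P. w x y q) - K x y"
      by (simp add: K_def right_diff_distrib sum_subtractf)
    ultimately show ?thesis
      by linarith
  qed
  moreover have "K x y \<le> 1 / 2" if xy: "x \<in> C" "y \<in> C" "T \<le> \<delta> x y" for x y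
  proof -
    have "\<bar>K x y\<bar> \<le> exp (- t * B\<^sup>2)"
      unfolding K_def
    proof (rule bound[OF xy(1,2)])
      fix q assume "q \<in> P" "\<xi> x q \<noteq> 0" "\<xi> y q \<noteq> 0"
      then have "B\<^sup>2 \<le> (norm (v q x - v q y))\<^sup>2"
        using lower xy \<open>0 \<le> B\<close> by (intro power_mono) auto
      then show "\<bar>E x y q\<bar> \<le> exp (- t * B\<^sup>2)"
        using \<open>0 \<le> t\<close> by (simp add: E_def mult_left_mono)
    qed simp
    with assms(5) show ?thesis by linarith
  qed
  ultimately show ?thesis
    unfolding separating_kernel_def by blast
qed

section \<open>Extensions of finite groups\<close>

lemma word_dist_nonneg: "0 \<le> word_dist G S x y"
  by (simp add: word_dist_def)

lemma (in group) word_dist_mult_left: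
  assumes "g \<in> carrier G" "x \<in> carrier G" "y \<in> carrier G"
  shows "word_dist G S (g \<otimes> x) (g \<otimes> y) = word_dist G S x y"
proof -
  have "inv (g \<otimes> x) \<otimes> (g \<otimes> y) = inv x \<otimes> (inv g \<otimes> g) \<otimes> y"
    using assms by (simp only: inv_mult_group m_assoc inv_closed m_closed)
  then show ?thesis
    using assms by (simp add: word_dist_def)
qed

lemma (in normal) quotient_dist_le:
  assumes "x \<in> carrier G" "y \<in> carrier G"
  shows "quotient_dist G S (H #> x) (H #> y) \<le> word_dist G S x y"
  unfolding quotient_dist_def
  using assms by (intro set_dist_le word_dist_nonneg rcos_self subgroup_axioms)

text \<open>A minimising pair \<open>a\<close>, \<open>c\<close> exists by finiteness. With
  \<open>a = m \<otimes> x\<close>, left translation by \<open>inv m\<close> is an isometry that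
  preserves every right coset of \<open>H\<close> and carries \<open>a\<close> to \<open>x\<close>,
  so the first point can be prescribed.\<close>

lemma (in normal) quotient_dist_attained:
  assumes fin: "finite (carrier G)" and "x \<in> carrier G" "g \<in> carrier G"
  shows "\<exists>y\<in>H #> g. word_dist G S x y = quotient_dist G S (H #> x) (H #> g)"
proof -
  have sub: "H #> x \<subseteq> carrier G" "H #> g \<subseteq> carrier G"
    using assms r_coset_subset_G[OF subset] by blast+
  have "H #> x \<noteq> {}" "H #> g \<noteq> {}"
    using assms rcos_self[OF _ subgroup_axioms] by blast+
  with set_dist_attained[OF sub[THEN finite_subset, OF fin]] sub
  obtain a c where a: "a \<in> H #> x" "a \<in> carrier G" and c: "c \<in> H #> g" "c \<in> carrier G"
    and ac: "word_dist G S a c = quotient_dist G S (H #> x) (H #> g)"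
    unfolding quotient_dist_def by blast
  obtain m where m: "m \<in> H" "a = m \<otimes> x"
    using a by (auto simp: r_coset_def)
  obtain l where l: "l \<in> H" "c = l \<otimes> g"
    using c by (auto simp: r_coset_def)
  have mC: "m \<in> carrier G" and lC: "l \<in> carrier G"
    using m l subset by auto
  have "inv m \<otimes> c = (inv m \<otimes> l) \<otimes> g"
    using l lC mC assms by (simp add: m_assoc)
  moreover have "inv m \<otimes> l \<in> H"
    using m l by simp
  ultimately have "inv m \<otimes> c \<in> H #> g"
    by (auto simp: r_coset_def)
  moreover have "inv m \<otimes> a = x"
    using m mC assms by (simp add: m_assoc[symmetric])
  then have "word_dist G S x (inv m \<otimes> c) = word_dist G S a c"
    using word_dist_mult_left[of "inv m" a c S] a c mC by simp
  ultimately show ?thesis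
    using ac by auto
qed

text \<open>Points of \<open>C\<close> whose coset is within \<open>s\<close> of \<open>q\<close>
  move to nearest points of \<open>q\<close>, and a left translation takes \<open>q\<close> to
  \<open>H\<close>. Distances change by at most \<open>2 * s\<close>, so the image has diameter at
  most \<open>L + 2 * s\<close>. The number \<open>r\<close> is the distance of the moved points.
  The metric \<open>\<delta>\<close> supplies symmetry and the triangle inequality for
  \<open>word_dist\<close> on the group.\<close>

lemma (in normal) fibre_maps:
  assumes fin: "finite (carrier G)"
    and metric: "Metric_space (carrier G) \<delta>"
    and \<delta>: "\<And>x y. x \<in> carrier G \<Longrightarrow> y \<in> carrier G \<Longrightarrow> \<delta> x y = word_dist G S x y"
    and C: "C \<subseteq> carrier G" and diam: "\<And>x y. x \<in> C \<Longrightarrow> y \<in> C \<Longrightarrow> word_dist G S x y \<le> L"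
    and emb: "\<And>D. D \<subseteq> H \<Longrightarrow> (\<And>x y. x \<in> D \<Longrightarrow> y \<in> D \<Longrightarrow> word_dist G S x y \<le> L + 2 * s) \<Longrightarrow>
      \<exists>f :: 'a \<Rightarrow> 'h::real_normed_vector. controlled \<rho>\<^sub>1 \<rho>\<^sub>2 (word_dist G S) D f"
    and q: "q \<in> carrier (G Mod H)"
  shows "\<exists>v :: 'a \<Rightarrow> 'h. \<forall>x\<in>C. \<forall>y\<in>C.
    quotient_dist G S (H #> x) q \<le> s \<and> quotient_dist G S (H #> y) q \<le> s \<longrightarrow>
    (\<exists>r\<ge>0. \<bar>r - word_dist G S x y\<bar> \<le> 2 * s \<and> \<rho>\<^sub>1 r \<le> norm (v x - v y) \<and> norm (v x - v y) \<le> \<rho>\<^sub>2 r)"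
proof -
  interpret M: Metric_space "carrier G" \<delta>
    by (rule metric)
  obtain g where g: "g \<in> carrier G" "q = H #> g"
    using q by (auto simp: carrier_FactGroup)
  define P where "P = {x \<in> C. quotient_dist G S (H #> x) q \<le> s}"
  have PC: "x \<in> carrier G" if "x \<in> P" for x
    using that C by (auto simp: P_def)
  have "\<forall>x. \<exists>y. x \<in> P \<longrightarrow> y \<in> q \<and> word_dist G S x y \<le> s"
  proof (intro allI)
    fix x
    show "\<exists>y. x \<in> P \<longrightarrow> y \<in> q \<and> word_dist G S x y \<le> s"
    proof (cases "x \<in> P")
      case True
      then have "quotient_dist G S (H #> x) q \<le> s"
        by (simp add: P_def)
      then show ?thesis
        using quotient_dist_attained[OF fin PC[OF True] g(1), of S] g(2) by auto
    qed simp
  qed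
  then obtain p where p: "\<And>x. x \<in> P \<Longrightarrow> p x \<in> q" "\<And>x. x \<in> P \<Longrightarrow> word_dist G S x (p x) \<le> s"
    unfolding choice_iff by blast
  have pC: "p x \<in> carrier G" if "x \<in> P" for x
    using p(1)[OF that] g subset r_coset_subset_G by blast
  define h where "h x = inv g \<otimes> p x" for x
  have hH: "h x \<in> H" if "x \<in> P" for x
  proof -
    \<comment> \<open>Normality enters here: the right coset \<open>q\<close> is also the left coset
      of \<open>g\<close>, so translating by \<open>inv g\<close> on the left, the side on which the
      metric is invariant, lands in \<open>H\<close>.\<close>
    have "p x \<in> g <# H"
      using p(1)[OF that] g coset_eq by simp
    then obtain m where m: "m \<in> H" "p x = g \<otimes> m"
      by (auto simp: l_coset_def)
    then have "m \<in> carrier G"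
      using subset by auto
    with m g show ?thesis
      by (simp add: h_def m_assoc[symmetric])
  qed
  have hd: "word_dist G S (h x) (h y) = word_dist G S (p x) (p y)" if "x \<in> P" "y \<in> P" for x y
    using that g pC by (simp add: h_def word_dist_mult_left)
  have close: "\<bar>word_dist G S (h x) (h y) - word_dist G S x y\<bar> \<le> 2 * s" if "x \<in> P" "y \<in> P" for x y
  proof -
    note c = PC[OF that(1)] PC[OF that(2)] pC[OF that(1)] pC[OF that(2)]
    have "\<delta> x (p x) \<le> s" "\<delta> y (p y) \<le> s"
      using p(2) that c by (simp_all add: \<delta>)
    then have "\<bar>\<delta> (p x) (p y) - \<delta> x y\<bar> \<le> 2 * s"
      using M.triangle[OF c(3,1,4)] M.triangle[OF c(1,2,4)] M.triangle[OF c(1,3,2)]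
        M.triangle[OF c(3,4,2)] M.commute[of "p x" x] M.commute[of "p y" y] by linarith
    then show ?thesis
      using c by (simp add: \<delta> hd[OF that])
  qed
  have "h ` P \<subseteq> H"
    using hH by blast
  moreover have "word_dist G S x y \<le> L + 2 * s" if "x \<in> h ` P" "y \<in> h ` P" for x y
  proof -
    obtain x' y' where xy: "x = h x'" "y = h y'" "x' \<in> P" "y' \<in> P"
      using \<open>x \<in> h ` P\<close> \<open>y \<in> h ` P\<close> by blast
    then have "word_dist G S x' y' \<le> L"
      using diam by (simp add: P_def)
    then show ?thesis
      using close[OF xy(3,4)] unfolding xy by linarith
  qed
  ultimately obtain f :: "'a \<Rightarrow> 'h" where f: "controlled \<rho>\<^sub>1 \<rho>\<^sub>2 (word_dist G S) (h ` P) f"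
    using emb[of "h ` P"] by blast
  show ?thesis
  proof (intro exI[of _ "\<lambda>x. f (h x)"] ballI impI)
    fix x y assume "x \<in> C" "y \<in> C"
      "quotient_dist G S (H #> x) q \<le> s \<and> quotient_dist G S (H #> y) q \<le> s"
    then have xy: "x \<in> P" "y \<in> P"
      by (auto simp: P_def)
    show "\<exists>r\<ge>0. \<bar>r - word_dist G S x y\<bar> \<le> 2 * s \<and>
        \<rho>\<^sub>1 r \<le> norm (f (h x) - f (h y)) \<and> norm (f (h x) - f (h y)) \<le> \<rho>\<^sub>2 r"
      using close[OF xy] f xy unfolding controlled_def
      by (intro exI[of _ "word_dist G S (h x) (h y)"]) (simp add: word_dist_nonneg)
  qed
qed

section \<open>Choice of constants and assembly for the extensions\<close>

theorem proposition2p7: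
  fixes G :: "nat \<Rightarrow> ('a, 'b) monoid_scheme"
    and N S :: "nat \<Rightarrow> 'a set"
    and b :: nat
    and d\<^sub>N d\<^sub>G :: "nat \<times> 'a \<Rightarrow> nat \<times> 'a \<Rightarrow> real"
    and d\<^sub>Q :: "nat \<times> 'a set \<Rightarrow> nat \<times> 'a set \<Rightarrow> real"
  assumes "\<And>n. group (G n)"
    and "\<And>n. finite (carrier (G n))"
    and "\<And>n. N n \<lhd> G n"
    and "0 < b"
    and "\<And>n. S n \<subseteq> carrier (G n)"
    and "\<And>n. generate (G n) (S n) = carrier (G n)"
    and "\<And>n. card (S n) \<le> b"
    and "coarse_disjoint_union N (\<lambda>n. word_dist (G n) (S n)) d\<^sub>N"
    and "coarse_disjoint_union (\<lambda>n. carrier (G n Mod N n)) (\<lambda>n. quotient_dist (G n) (S n)) d\<^sub>Q"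
    and "coarse_disjoint_union (\<lambda>n. carrier (G n)) (\<lambda>n. word_dist (G n) (S n)) d\<^sub>G"
    and "Metric_space.coarsely_embeds_at_infinity (Sigma UNIV N) d\<^sub>N
           TYPE('h::{real_inner, complete_space})"
    and "Metric_space.property_A_at_infinity (SIGMA n:UNIV. carrier (G n Mod N n)) d\<^sub>Q"
  shows "Metric_space.coarsely_embeds_at_infinity (SIGMA n:UNIV. carrier (G n)) d\<^sub>G TYPE(ell2)"
proof (rule coarsely_embeds_at_infinity_of_kernels)
  show "coarse_disjoint_union (\<lambda>n. carrier (G n)) (\<lambda>n. word_dist (G n) (S n)) d\<^sub>G"
    by fact
  show fin: "finite (carrier (G n))" for n
    by fact
  have finN: "finite (N n)" for n
    by (rule finite_subset[OF subgroup.subset[OF normal.axioms(1)[OF assms(3)]] fin])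
  have finQ: "finite (carrier (G n Mod N n))" for n
    using fin by (simp add: carrier_FactGroup)
  have d\<^sub>G: "d\<^sub>G (n, x) (n, y) = word_dist (G n) (S n) x y"
    if "x \<in> carrier (G n)" "y \<in> carrier (G n)" for n x y
    using assms(10) that by (simp add: coarse_disjoint_union_def)
  obtain \<rho>\<^sub>1 \<rho>\<^sub>2 where \<rho>: "mono_on {0..} \<rho>\<^sub>2" "filterlim \<rho>\<^sub>1 at_top at_top"
    and emb: "\<forall>L. eventually_small_sets N (\<lambda>n. word_dist (G n) (S n)) L
      (\<lambda>n C. \<exists>f :: 'a \<Rightarrow> 'h. controlled \<rho>\<^sub>1 \<rho>\<^sub>2 (word_dist (G n) (S n)) C f)"
    by (rule coarsely_embeds_at_infinityD[OF assms(8) finN assms(11)])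
  fix R \<epsilon> :: real
  assume "0 < R" "0 < \<epsilon>"
  \<comment> \<open>Half of \<open>\<epsilon>\<close> goes to the Property A vectors, the other half
    to the Gaussian factor.\<close>
  then have "0 < \<epsilon> / 2" by simp
  obtain s where s: "\<forall>L. eventually_small_sets (\<lambda>n. carrier (G n Mod N n))
      (\<lambda>n. quotient_dist (G n) (S n)) L (\<lambda>n C. \<exists>\<xi>. A_map R (\<epsilon> / 2) s (quotient_dist (G n) (S n)) C \<xi>)"
    by (rule property_A_at_infinityD[OF assms(9) finQ assms(12) \<open>0 < R\<close> \<open>0 < \<epsilon> / 2\<close>])
  \<comment> \<open>Pairs at distance at most \<open>R\<close> are at most \<open>R + 2 * s\<close>
    apart after moving into a coset, so \<open>A\<close> bounds the distance of their images under a
    fibre map.\<close>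
  define A where "A = \<rho>\<^sub>2 (R + 2 * s)"
  \<comment> \<open>The summand 1 keeps the denominator of \<open>t\<close> positive even if
    \<open>A = 0\<close>.\<close>
  define c where "c = A\<^sup>2 + 1"
  define t where "t = \<epsilon> / 2 / c"
  have "0 < c"
    by (simp add: c_def add_nonneg_pos)
  then have "0 < t" "t * c = \<epsilon> / 2"
    using \<open>0 < \<epsilon>\<close> by (simp_all add: t_def)
  then have tA: "t * A\<^sup>2 \<le> \<epsilon> / 2"
    using \<open>0 < t\<close> by (simp add: c_def algebra_simps)
  \<comment> \<open>Chosen so that \<open>t * B\<^sup>2 = 1\<close>. The Gaussian is then at most
    \<open>exp (- 1)\<close>, which is below 1/2.\<close>
  define B where "B = sqrt (1 / t)"
  have "0 \<le> B"
    using \<open>0 < t\<close> by (simp add: B_def)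
  have tB: "exp (- t * B\<^sup>2) \<le> 1 / 2"
  proof -
    have "t * B\<^sup>2 = 1"
      using \<open>0 < t\<close> by (simp add: B_def)
    then have "exp (- t * B\<^sup>2) = inverse (exp 1)"
      by (simp add: exp_minus)
    also have "\<dots> \<le> inverse 2"
      using exp_ge_add_one_self[of 1] by (intro le_imp_inverse_le) auto
    finally show ?thesis by simp
  qed
  obtain T0 where T0: "\<And>r. T0 \<le> r \<Longrightarrow> B \<le> \<rho>\<^sub>1 r"
    using \<rho>(2) unfolding filterlim_at_top eventually_at_top_linorder by blast
  \<comment> \<open>Moving into a coset loses at most \<open>2 * s\<close>, so points at distance
    \<open>T\<close> remain at least \<open>T0\<close> apart. All constants so far are independent
    of \<open>L\<close>.\<close>
  define T where "T = T0 + 2 * s"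
  have "eventually_small_sets (\<lambda>n. carrier (G n)) (\<lambda>n. word_dist (G n) (S n)) L
      (\<lambda>n C. \<exists>K. separating_kernel R \<epsilon> T (word_dist (G n) (S n)) C K)" for L
  proof -
    obtain k1 where k1: "\<forall>n\<ge>k1. \<forall>C\<subseteq>N n. (\<forall>x\<in>C. \<forall>y\<in>C. word_dist (G n) (S n) x y \<le> L + 2 * s) \<longrightarrow>
        (\<exists>f :: 'a \<Rightarrow> 'h. controlled \<rho>\<^sub>1 \<rho>\<^sub>2 (word_dist (G n) (S n)) C f)"
      using emb[rule_format, of "L + 2 * s"] unfolding eventually_small_sets_def ..
    obtain k2 where k2: "\<forall>n\<ge>k2. \<forall>C\<subseteq>carrier (G n Mod N n).
        (\<forall>x\<in>C. \<forall>y\<in>C. quotient_dist (G n) (S n) x y \<le> L) \<longrightarrow>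
        (\<exists>\<xi>. A_map R (\<epsilon> / 2) s (quotient_dist (G n) (S n)) C \<xi>)"
      using s[rule_format, of L] unfolding eventually_small_sets_def ..
    show ?thesis
    proof (rule eventually_small_setsI)
      fix n C
      assume "max k1 k2 \<le> n" and C: "C \<subseteq> carrier (G n)"
        and diam: "\<And>x y. x \<in> C \<Longrightarrow> y \<in> C \<Longrightarrow> word_dist (G n) (S n) x y \<le> L"
      then have n: "k1 \<le> n" "k2 \<le> n" by simp_all
      let ?d = "word_dist (G n) (S n)" and ?dQ = "quotient_dist (G n) (S n)"
      interpret normal "N n" "G n"
        by fact
      define \<pi> where "\<pi> x = N n #>\<^bsub>G n\<^esub> x" for x
      \<comment> \<open>The projection does not increase distances, so \<open>P\<close> has diameter
        at most \<open>L\<close> and Property A applies to \<open>P\<close> itself.\<close>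
      define P where "P = \<pi> ` C"
      have \<pi>P: "\<pi> x \<in> P" if "x \<in> C" for x
        using that by (simp add: P_def)
      have \<pi>_le: "?dQ (\<pi> x) (\<pi> y) \<le> ?d x y" if "x \<in> C" "y \<in> C" for x y
        unfolding \<pi>_def using that C by (intro quotient_dist_le) auto
      have P: "P \<subseteq> carrier (G n Mod N n)"
        using C by (auto simp: P_def \<pi>_def carrier_FactGroup)
      have "?dQ x y \<le> L" if "x \<in> P" "y \<in> P" for x y
      proof -
        obtain x' y' where "x = \<pi> x'" "y = \<pi> y'" "x' \<in> C" "y' \<in> C"
          using \<open>x \<in> P\<close> \<open>y \<in> P\<close> unfolding P_def by blast
        then show ?thesis
          using \<pi>_le[of x' y'] diam[of x' y'] by simp
      qed
      then obtain \<xi> where A_map: "A_map R (\<epsilon> / 2) s ?dQ P \<xi>"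
        using k2 n(2) P by blast
      have "\<forall>q. \<exists>v :: 'a \<Rightarrow> 'h. q \<in> P \<longrightarrow> (\<forall>x\<in>C. \<forall>y\<in>C. ?dQ (\<pi> x) q \<le> s \<and> ?dQ (\<pi> y) q \<le> s \<longrightarrow>
        (\<exists>r\<ge>0. \<bar>r - ?d x y\<bar> \<le> 2 * s \<and> \<rho>\<^sub>1 r \<le> norm (v x - v y) \<and> norm (v x - v y) \<le> \<rho>\<^sub>2 r))"
      proof (intro allI)
        fix q
        show "\<exists>v :: 'a \<Rightarrow> 'h. q \<in> P \<longrightarrow> (\<forall>x\<in>C. \<forall>y\<in>C. ?dQ (\<pi> x) q \<le> s \<and> ?dQ (\<pi> y) q \<le> s \<longrightarrow>
          (\<exists>r\<ge>0. \<bar>r - ?d x y\<bar> \<le> 2 * s \<and> \<rho>\<^sub>1 r \<le> norm (v x - v y) \<and> norm (v x - v y) \<le> \<rho>\<^sub>2 r))"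
        proof (cases "q \<in> P")
          case True
          have "\<exists>v :: 'a \<Rightarrow> 'h. \<forall>x\<in>C. \<forall>y\<in>C. ?dQ (\<pi> x) q \<le> s \<and> ?dQ (\<pi> y) q \<le> s \<longrightarrow>
            (\<exists>r\<ge>0. \<bar>r - ?d x y\<bar> \<le> 2 * s \<and> \<rho>\<^sub>1 r \<le> norm (v x - v y) \<and> norm (v x - v y) \<le> \<rho>\<^sub>2 r)"
            unfolding \<pi>_def
          proof (rule fibre_maps[OF fin Metric_space_component[OF assms(10)] d\<^sub>G C diam])
            show "q \<in> carrier (G n Mod N n)"
              using True P by blast
            show "\<exists>f :: 'a \<Rightarrow> 'h. controlled \<rho>\<^sub>1 \<rho>\<^sub>2 ?d D f"
              if "D \<subseteq> N n" "\<And>x y. x \<in> D \<Longrightarrow> y \<in> D \<Longrightarrow> ?d x y \<le> L + 2 * s" for D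
              using k1 n(1) that by blast
          qed
          then show ?thesis by blast
        qed simp
      qed
      then obtain v :: "'a set \<Rightarrow> 'a \<Rightarrow> 'h" where v: "\<forall>q. q \<in> P \<longrightarrow> (\<forall>x\<in>C. \<forall>y\<in>C.
          ?dQ (\<pi> x) q \<le> s \<and> ?dQ (\<pi> y) q \<le> s \<longrightarrow>
          (\<exists>r\<ge>0. \<bar>r - ?d x y\<bar> \<le> 2 * s \<and> \<rho>\<^sub>1 r \<le> norm (v q x - v q y) \<and> norm (v q x - v q y) \<le> \<rho>\<^sub>2 r))"
        unfolding choice_iff by (rule exE)
      \<comment> \<open>If both vectors are nonzero at \<open>q\<close>, their support radius puts
        the cosets of \<open>x\<close> and \<open>y\<close> within \<open>s\<close> of
        \<open>q\<close>, where the fibre map is controlled.\<close>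
      have v\<xi>: "\<exists>r\<ge>0. \<bar>r - ?d x y\<bar> \<le> 2 * s \<and>
            \<rho>\<^sub>1 r \<le> norm (v q x - v q y) \<and> norm (v q x - v q y) \<le> \<rho>\<^sub>2 r"
        if "x \<in> C" "y \<in> C" "q \<in> P" "\<xi> (\<pi> x) q \<noteq> 0" "\<xi> (\<pi> y) q \<noteq> 0" for x y q
      proof -
        have "?dQ (\<pi> x) q \<le> s" "?dQ (\<pi> y) q \<le> s"
          using A_map \<pi>P that unfolding A_map_def by blast+
        then show ?thesis
          using v that(1-3) by simp
      qed
      have "\<exists>K. separating_kernel R (\<epsilon> / 2 + t * A\<^sup>2) T ?d C K"
      proof (rule glued_kernel[where \<xi> = "\<lambda>x. \<xi> (\<pi> x)" and v = v and P = P])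
        show "finite C" "finite P"
          using finite_subset[OF C fin] by (auto simp: P_def)
        show "0 \<le> t" "0 \<le> B" "exp (- t * B\<^sup>2) \<le> 1 / 2"
          using \<open>0 < t\<close> \<open>0 \<le> B\<close> tB by auto
        fix x assume x: "x \<in> C"
        show "L2_set (\<lambda>q. cmod (\<xi> (\<pi> x) q)) P = 1"
          using A_map \<pi>P[OF x] by (simp add: A_map_def)
        fix y assume y: "y \<in> C"
        show "cmod (1 - (\<Sum>q\<in>P. \<xi> (\<pi> x) q * cnj (\<xi> (\<pi> y) q))) \<le> \<epsilon> / 2" if "?d x y \<le> R"
          using A_map \<pi>P[OF x] \<pi>P[OF y] order_trans[OF \<pi>_le[OF x y] that]
          unfolding A_map_def by blast
        fix q assume q: "q \<in> P"
        show "norm (v q x - v q y) \<le> A"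
          if le: "?d x y \<le> R" and nz: "\<xi> (\<pi> x) q \<noteq> 0" "\<xi> (\<pi> y) q \<noteq> 0"
        proof -
          obtain r where r: "0 \<le> r" "\<bar>r - ?d x y\<bar> \<le> 2 * s" "norm (v q x - v q y) \<le> \<rho>\<^sub>2 r"
            using v\<xi>[OF x y q nz] by blast
          then have "r \<le> R + 2 * s"
            using le by linarith
          then have "\<rho>\<^sub>2 r \<le> A"
            unfolding A_def using r(1) by (intro mono_onD[OF \<rho>(1)]) auto
          with r(3) show ?thesis by linarith
        qed
        show "B \<le> norm (v q x - v q y)"
          if le: "T \<le> ?d x y" and nz: "\<xi> (\<pi> x) q \<noteq> 0" "\<xi> (\<pi> y) q \<noteq> 0"
        proof -
          obtain r where r: "\<bar>r - ?d x y\<bar> \<le> 2 * s" "\<rho>\<^sub>1 r \<le> norm (v q x - v q y)"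
            using v\<xi>[OF x y q nz] by blast
          then have "T0 \<le> r"
            using le unfolding T_def by linarith
          from T0[OF this] r(2) show ?thesis by linarith
        qed
      qed
      then obtain K where "separating_kernel R (\<epsilon> / 2 + t * A\<^sup>2) T ?d C K" by blast
      moreover have "\<epsilon> / 2 + t * A\<^sup>2 \<le> \<epsilon>"
        using tA by simp
      ultimately have "separating_kernel R \<epsilon> T ?d C K"
        unfolding separating_kernel_def by (meson order_trans)
      then show "\<exists>K. separating_kernel R \<epsilon> T ?d C K" by blast
    qed
  qed
  then show "\<exists>T. \<forall>L. eventually_small_sets (\<lambda>n. carrier (G n)) (\<lambda>n. word_dist (G n) (S n)) L
      (\<lambda>n C. \<exists>K. separating_kernel R \<epsilon> T (word_dist (G n) (S n)) C K)"
    by blast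
qed

end
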